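(* Let $\Theta\subseteq\mathbb{R}^p$, $D\subseteq\mathbb{R}^l$ be closed sets with $0\in\Theta$, $0\in D$, and let $\Gamma,\varepsilon>0$. Consider $$\dot\xi=f(\xi,z,\theta,d),\qquad \dot z=\Gamma e^{-z}\big(V(\xi,z)-\varepsilon\big)^+,$$ with state $(\xi,z)\in\mathbb{R}^n\times\mathbb{R}$ and inputs $\theta\in\Theta$, $d\in D$, where $f:\mathbb{R}^n\times\mathbb{R}\times\Theta\times D\to\mathbb{R}^n$ is continuous, locally Lipschitz in $(\xi,z)$ (uniformly for $(\theta,d)$ in bounded sets), with $f(0,z,\theta,0)=0$ for all $(z,\theta)$, and $V\in C^1(\mathbb{R}^n\times\mathbb{R})$ satisfies $V(0,z)=0$ for all $z$ and $V(\xi,z)>0$ for $\xi\ne0$. Assume: (i) for every $M>0$ the set $\{(\xi,z)\in\mathbb{R}^n\times[-M,M]: V(\xi,z)\le M\}$ is bounded; (ii) there exist $\kappa,\lambda,\rho\in K_\infty$ and constants $a,c,\delta>0$, $b\ge0$ with $\rho(s)\ge cs$ for all $s\in[0,\delta]$, such that for all $(\xi,z)\in\mathbb{R}^n\times\mathbb{R}$, $\theta\in\Theta$, $d\in D$: $$\frac{\partial V}{\partial\xi}(\xi,z)f(\xi,z,\theta,d)+\Gamma e^{-z}\frac{\partial V}{\partial z}(\xi,z)\big(V(\xi,z)-\varepsilon\big)^+\le-\rho(V(\xi,z))+\chi(|d|,|\theta|,e^{z}),$$ where $\chi(s_1,s_2,s_3)=a\,\dfrac{s_1^2+\big((s_2-b-\lambda(s_3))^+\big)^2}{1+\kappa(s_3)}$.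 Then there exist $B\in C^0(\mathbb{R}^n\times\mathbb{R}\times\mathbb{R}_+\times\mathbb{R}_+)$, $\gamma\in K_\infty$ and $\sigma\in KL$ such that for every $(\xi_0,z_0)\in\mathbb{R}^n\times\mathbb{R}$, $d\in L^\infty(\mathbb{R}_+;D)$, $\theta\in L^\infty(\mathbb{R}_+;\Theta)$, the unique solution with $(\xi(0),z(0))=(\xi_0,z_0)$ exists for all $t\ge0$, $\lim_{t\to\infty}z(t)$ exists and is finite, and for all $t\ge0$: $$\limsup_{t\to\infty}V(\xi(t),z(t))\le\varepsilon,$$ $$\limsup_{t\to\infty}V(\xi(t),z(t))\le\gamma\Big(\chi\big(\limsup_{t\to\infty}|d(t)|,\ \limsup_{t\to\infty}|\theta(t)|,\ \exp(\lim_{t\to\infty}z(t))\big)\Big),$$ $$V(\xi(t),z(t))\le\sigma(V(\xi_0,z_0),t)+\gamma\big(\chi(\|d\|_\infty,\|\theta\|_\infty,e^{z_0})\big),$$ $$|\xi(t)|\le B(\xi_0,z_0,\|d\|_\infty,\|\theta\|_\infty),\qquad z_0\le z(t)\le\lim_{s\to\infty}z(s)\le B(\xi_0,z_0,\|d\|_\infty,\|\theta\|_\infty).$$ Moreover, if $\rho(s)\ge cs$ for all $s\ge0$, then one may take $\gamma(s)=s/c$ and $\sigma(s,t)=e^{-ct}s$. *)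

theory Defs
  imports "HOL-Analysis.Analysis" "HOL-Probability.Essential_Supremum"
begin

definition pos_part :: "real \<Rightarrow> real" where
  "pos_part x = max x 0"

definition class_K :: "(real \<Rightarrow> real) \<Rightarrow> bool" where
  "class_K \<alpha> \<longleftrightarrow> continuous_on {0..} \<alpha> \<and> \<alpha> 0 = 0 \<and> strict_mono_on {0..} \<alpha>"

definition class_Kinf :: "(real \<Rightarrow> real) \<Rightarrow> bool" where
  "class_Kinf \<alpha> \<longleftrightarrow> class_K \<alpha> \<and> filterlim \<alpha> at_top at_top"

definition class_KL :: "(real \<Rightarrow> real \<Rightarrow> real) \<Rightarrow> bool" where
  "class_KL \<sigma> \<longleftrightarrow>
     continuous_on ({0..} \<times> {0..}) (\<lambda>(s,t). \<sigma> s t) \<and>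
     (\<forall>t\<ge>0. class_K (\<lambda>s. \<sigma> s t)) \<and>
     (\<forall>s\<ge>0. (\<forall>t1 t2. 0 \<le> t1 \<longrightarrow> t1 \<le> t2 \<longrightarrow> \<sigma> s t2 \<le> \<sigma> s t1) \<and> ((\<sigma> s) \<longlongrightarrow> 0) at_top)"

definition chi :: "real \<Rightarrow> real \<Rightarrow> (real \<Rightarrow> real) \<Rightarrow> (real \<Rightarrow> real) \<Rightarrow> real \<Rightarrow> real \<Rightarrow> real \<Rightarrow> real" where
  "chi a b lam kap s1 s2 s3 = a * (s1^2 + (pos_part (s2 - b - lam s3))^2) / (1 + kap s3)"

definition ess_norm :: "(real \<Rightarrow> 'b::real_normed_vector) \<Rightarrow> ereal" where
  "ess_norm u = esssup (restrict_space lborel {0..}) (\<lambda>t. ereal (norm (u t)))"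

definition ess_limsup_norm :: "(real \<Rightarrow> 'b::real_normed_vector) \<Rightarrow> ereal" where
  "ess_limsup_norm u = (INF T\<in>{0..}. esssup (restrict_space lborel {T..}) (\<lambda>t. ereal (norm (u t))))"

(* u \<in> L^\<infinity>(R_+; S): measurable, values in S, essentially bounded
   (a representative with values in S everywhere on R_+) *)
definition Linf_input :: "'b::euclidean_space set \<Rightarrow> (real \<Rightarrow> 'b) \<Rightarrow> bool" where
  "Linf_input S u \<longleftrightarrow> u \<in> borel_measurable (restrict_space lborel {0..}) \<and>
     (\<forall>t\<ge>0. u t \<in> S) \<and> ess_norm u < \<infinity>"

definition rhs :: "('a::euclidean_space \<Rightarrow> real \<Rightarrow> 'p \<Rightarrow> 'l \<Rightarrow> 'a) \<Rightarrow> ('a \<Rightarrow> real \<Rightarrow> real) \<Rightarrow> real \<Rightarrow> real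
     \<Rightarrow> 'p \<Rightarrow> 'l \<Rightarrow> 'a \<times> real \<Rightarrow> 'a \<times> real" where
  "rhs f V \<Gamma> \<epsilon> th dd x = (f (fst x) (snd x) th dd, \<Gamma> * exp (- snd x) * pos_part (V (fst x) (snd x) - \<epsilon>))"

(* Caratheodory solution on [0,T) with initial value x0 (integral form) *)
definition sol_on :: "('a::euclidean_space \<Rightarrow> real \<Rightarrow> 'p \<Rightarrow> 'l \<Rightarrow> 'a) \<Rightarrow> ('a \<Rightarrow> real \<Rightarrow> real) \<Rightarrow> real \<Rightarrow> real
     \<Rightarrow> (real \<Rightarrow> 'p) \<Rightarrow> (real \<Rightarrow> 'l) \<Rightarrow> 'a \<times> real \<Rightarrow> real \<Rightarrow> (real \<Rightarrow> 'a \<times> real) \<Rightarrow> bool" where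
  "sol_on f V \<Gamma> \<epsilon> \<theta> d x0 T x \<longleftrightarrow>
     (\<forall>t\<in>{0..<T}. (\<lambda>s. rhs f V \<Gamma> \<epsilon> (\<theta> s) (d s) (x s)) integrable_on {0..t} \<and>
        x t = x0 + integral {0..t} (\<lambda>s. rhs f V \<Gamma> \<epsilon> (\<theta> s) (d s) (x s)))"

definition global_sol where
  "global_sol f V \<Gamma> \<epsilon> \<theta> d x0 x \<longleftrightarrow> (\<forall>T. sol_on f V \<Gamma> \<epsilon> \<theta> d x0 T x)"

definition conclusion_holds where
  "conclusion_holds f V \<Gamma> \<epsilon> \<Theta> D a b lam kap B \<gamma> \<sigma> \<longleftrightarrow>
    (\<forall>\<xi>0 z0 \<theta> d. Linf_input \<Theta> \<theta> \<and> Linf_input D d \<longrightarrow>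
      (let nd = real_of_ereal (ess_norm d); n\<theta> = real_of_ereal (ess_norm \<theta>) in
      (\<exists>x. global_sol f V \<Gamma> \<epsilon> \<theta> d (\<xi>0, z0) x \<and>
         (\<forall>T y. sol_on f V \<Gamma> \<epsilon> \<theta> d (\<xi>0, z0) T y \<longrightarrow> (\<forall>t\<in>{0..<T}. y t = x t)) \<and>
         (\<exists>zinf. ((\<lambda>t. snd (x t)) \<longlongrightarrow> zinf) at_top \<and>
            Limsup at_top (\<lambda>t. ereal (V (fst (x t)) (snd (x t)))) \<le> ereal \<epsilon> \<and>
            Limsup at_top (\<lambda>t. ereal (V (fst (x t)) (snd (x t)))) \<le>
              ereal (\<gamma> (chi a b lam kap (real_of_ereal (ess_limsup_norm d))
                                         (real_of_ereal (ess_limsup_norm \<theta>)) (exp zinf))) \<and>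
            (\<forall>t\<ge>0. V (fst (x t)) (snd (x t)) \<le> \<sigma> (V \<xi>0 z0) t + \<gamma> (chi a b lam kap nd n\<theta> (exp z0)) \<and>
                    norm (fst (x t)) \<le> B \<xi>0 z0 nd n\<theta> \<and>
                    z0 \<le> snd (x t) \<and> snd (x t) \<le> zinf) \<and>
            zinf \<le> B \<xi>0 z0 nd n\<theta>))))"

end

theory Submission
  imports Defs
begin

text \<open>
  Along a solution, \<open>W = V(\<xi>, z)\<close> satisfies \<open>W' \<le> - \<rho>(W) + \<chi>(|d|, |\<theta>|, e\<^sup>z)\<close>, and \<open>z\<close> is
  nondecreasing while \<open>\<chi>\<close> is nonincreasing in \<open>z\<close>. Comparison with the constant bound
  \<open>X = \<chi>(\<parallel>d\<parallel>, \<parallel>\<theta>\<parallel>, e\<^bsup>z\<^sub>0\<^esup>)\<close> gives the transient estimate: while \<open>\<rho>(W) \<ge> 2 X\<close> one has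
  \<open>W' \<le> - (c / 2) min W \<delta>\<close>, so \<open>W e\<^bsup>W/\<delta>\<^esup>\<close> decays exponentially; this yields
  \<open>\<gamma>(s) = \<rho>\<^sup>-\<^sup>1(2 s)\<close> and \<open>\<sigma>(s, t) = e\<^bsup>- c t / 2\<^esup> s e\<^bsup>s/\<delta>\<^esup>\<close>.

  Since \<open>(e\<^sup>z)' = \<Gamma> (W - \<epsilon>)\<^sup>+\<close> and \<open>\<chi> \<rightarrow> 0\<close> as \<open>z \<rightarrow> \<infinity>\<close>, the function
  \<open>(\<Gamma> / \<rho>(\<epsilon>)) ((W - \<epsilon>)\<^sup>+)\<^sup>2 + e\<^sup>z\<close> is nonincreasing as soon as \<open>\<chi> \<le> \<rho>(\<epsilon>) / 2\<close>, which bounds \<open>z\<close>;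
  the compactness of sublevel sets then bounds \<open>\<xi>\<close>, and the a priori bounds make a Picard solution
  of the system truncated to a large ball a global solution. As \<open>e\<^sup>z\<close> converges, its increments over
  short intervals vanish, and since \<open>W\<close> cannot rise faster than \<open>X\<close> this forces \<open>limsup W \<le> \<epsilon>\<close>.
  Restarting the comparison at late times gives the asymptotic gain.
\<close>

section \<open>Primitives of bounded functions\<close>

lemma norm_integral_le_const:
  fixes k :: "real \<Rightarrow> 'b::euclidean_space"
  assumes "u \<le> v" "k integrable_on {u..v}" "\<And>t. t \<in> {u..v} \<Longrightarrow> norm (k t) \<le> K"
  shows "norm (integral {u..v} k) \<le> K * (v - u)"
  using integral_norm_bound_integral[OF assms(2), of "\<lambda>_. K"] assms by (auto simp: mult.commute)

text \<open>Integral form of \<open>x' = g\<close>, suited to measurable inputs, for which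
  \<open>x\<close> need not be differentiable at every time. Boundedness of \<open>g\<close> makes
  \<open>x\<close> Lipschitz and makes products of \<open>g\<close> with continuous functions
  absolutely integrable.\<close>

definition primitive_on :: "real \<Rightarrow> real \<Rightarrow> (real \<Rightarrow> 'b::euclidean_space) \<Rightarrow> (real \<Rightarrow> 'b) \<Rightarrow> bool" where
  "primitive_on p q x g \<longleftrightarrow> g integrable_on {p..q} \<and> bounded (g ` {p..q}) \<and>
     (\<forall>s\<in>{p..q}. x s = x p + integral {p..s} g)"

lemma primitive_onD:
  assumes "primitive_on p q x g"
  shows "g integrable_on {p..q}" "bounded (g ` {p..q})"
    and "\<And>s. s \<in> {p..q} \<Longrightarrow> x s = x p + integral {p..s} g"
  using assms unfolding primitive_on_def by blast+

lemma primitive_onI: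
  assumes "g integrable_on {p..q}" "bounded (g ` {p..q})"
    and "\<And>s. s \<in> {p..q} \<Longrightarrow> x s = x p + integral {p..s} g"
  shows "primitive_on p q x g"
  using assms unfolding primitive_on_def by blast

lemma primitive_on_increment:
  assumes x: "primitive_on p q x g" and "p \<le> r" "r \<le> s" "s \<le> q"
  shows "x s - x r = integral {r..s} g"
proof -
  have "g integrable_on {p..s}"
    using assms integrable_on_subinterval[OF primitive_onD(1)[OF x], of p s] by auto
  then have "integral {p..r} g + integral {r..s} g = integral {p..s} g"
    using assms by (intro Henstock_Kurzweil_Integration.integral_combine) auto
  moreover have "x r = x p + integral {p..r} g" "x s = x p + integral {p..s} g"
    using assms by (auto intro!: primitive_onD(3)[OF x])
  ultimately show ?thesis by (simp add: algebra_simps)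
qed

lemma primitive_on_subinterval:
  assumes x: "primitive_on p q x g" and "p \<le> r" "s \<le> q"
  shows "primitive_on r s x g"
proof (rule primitive_onI)
  show "bounded (g ` {r..s})"
    using assms by (intro bounded_subset[OF primitive_onD(2)[OF x]]) auto
  show "g integrable_on {r..s}"
    using assms integrable_on_subinterval[OF primitive_onD(1)[OF x], of r s] by auto
  show "x u = x r + integral {r..u} g" if "u \<in> {r..s}" for u
    using primitive_on_increment[OF x, of r u] that assms by (auto simp: algebra_simps)
qed

lemma primitive_on_continuous:
  assumes "primitive_on p q x g"
  shows "continuous_on {p..q} x"
proof -
  have "continuous_on {p..q} (\<lambda>s. x p + integral {p..s} g)"
    by (intro continuous_intros indefinite_integral_continuous_1 primitive_onD(1)[OF assms])
  then show ?thesis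
    by (rule continuous_on_eq) (rule primitive_onD(3)[OF assms, symmetric])
qed

text \<open>Pairing allows time to be adjoined to a state, so that the chain rule also covers
  time-dependent weights. The pair of densities is a sum of two linear coordinate embeddings, which
  is how it is integrated.\<close>

lemma primitive_on_Pair:
  assumes x: "primitive_on p q x g" and y: "primitive_on p q y h"
  shows "primitive_on p q (\<lambda>s. (x s, y s)) (\<lambda>s. (g s, h s))"
proof -
  have *: "((\<lambda>s. (g s, h s)) has_integral (integral {p..u} g, integral {p..u} h)) {p..u}"
    if u: "u \<le> q" for u
  proof -
    have "(g has_integral integral {p..u} g) {p..u}" "(h has_integral integral {p..u} h) {p..u}"
      using primitive_onD(1)[OF primitive_on_subinterval[OF x order_refl u]]
        primitive_onD(1)[OF primitive_on_subinterval[OF y order_refl u]] by auto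
    then have "((\<lambda>s. (g s, 0) + (0, h s)) has_integral
        ((integral {p..u} g, 0) + (0, integral {p..u} h))) {p..u}"
      using has_integral_linear[of g _ _ "\<lambda>v. (v, 0::'b)"] has_integral_linear[of h _ _ "\<lambda>v. (0::'a, v)"]
      by (intro has_integral_add) (auto simp: o_def bounded_linear_Pair bounded_linear_ident bounded_linear_zero)
    then show ?thesis by simp
  qed
  have "bounded (g ` {p..q} \<times> h ` {p..q})"
    by (intro bounded_Times primitive_onD(2)[OF x] primitive_onD(2)[OF y])
  then have "bounded ((\<lambda>s. (g s, h s)) ` {p..q})" by (rule bounded_subset) auto
  moreover have "(x s, y s) = (x p, y p) + integral {p..s} (\<lambda>s. (g s, h s))" if s: "s \<in> {p..q}" for s
    using primitive_onD(3)[OF x s] primitive_onD(3)[OF y s] integral_unique[OF *, of s] s by simp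
  ultimately show ?thesis
    using *[of q] by (intro primitive_onI) (blast+)
qed

text \<open>The set \<open>N\<close> absorbs the times at which a differential inequality known
  almost everywhere may fail: resetting the density to \<open>m\<close> there leaves its integral
  unchanged.\<close>

lemma primitive_on_mono:
  fixes W w :: "real \<Rightarrow> real"
  assumes W: "primitive_on p q W w" and "p \<le> q" and N: "negligible N"
    and le: "\<And>s. s \<in> {p..q} - N \<Longrightarrow> w s \<le> m"
  shows "W q \<le> W p + m * (q - p)"
proof -
  let ?v = "\<lambda>s. if s \<in> N then m else w s"
  have "?v integrable_on {p..q}"
    by (intro integrable_spike[OF primitive_onD(1)[OF W] N]) auto
  then have "integral {p..q} ?v \<le> integral {p..q} (\<lambda>s. m)"
    using le by (intro integral_le) auto
  moreover have "integral {p..q} w = integral {p..q} ?v"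
    by (rule integral_spike[OF N]) auto
  moreover have "W q = W p + integral {p..q} w" using \<open>p \<le> q\<close> by (intro primitive_onD(3)[OF W]) auto
  ultimately show ?thesis using \<open>p \<le> q\<close> by (simp add: mult.commute)
qed

text \<open>Since \<open>g\<close> is bounded, \<open>G \<circ> x\<close> minus the candidate integral is differentiable with derivative
  zero at every point, so no Lebesgue differentiation theorem is needed.\<close>

lemma primitive_on_compose:
  fixes x g :: "real \<Rightarrow> 'b::euclidean_space" and G :: "'b \<Rightarrow> real"
  assumes x: "primitive_on p q x g"
    and G: "\<And>y. (G has_derivative (\<lambda>h. DG y \<bullet> h)) (at y)"
    and DG: "continuous_on UNIV DG"
  shows "primitive_on p q (\<lambda>s. G (x s)) (\<lambda>s. DG (x s) \<bullet> g s)"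
proof -
  let ?I = "{p..q}" and ?w = "\<lambda>s. DG (x s) \<bullet> g s"
  have xc: "continuous_on ?I x" by (rule primitive_on_continuous[OF x])
  have Dc: "continuous_on ?I (\<lambda>s. DG (x s))"
    using xc by (rule continuous_on_compose2[OF DG]) auto
  obtain C where C: "C > 0" "\<And>s. s \<in> ?I \<Longrightarrow> norm (g s) \<le> C"
    using primitive_onD(2)[OF x] by (auto simp: bounded_pos)
  have Db: "bounded ((\<lambda>s. DG (x s)) ` ?I)"
    using Dc compact_continuous_image compact_imp_bounded by blast
  then obtain C' where C': "C' > 0" "\<And>s. s \<in> ?I \<Longrightarrow> norm (DG (x s)) \<le> C'"
    by (auto simp: bounded_pos)
  have wb: "bounded (?w ` ?I)"
  proof (rule boundedI)
    fix v assume "v \<in> ?w ` ?I"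
    then obtain s where s: "s \<in> ?I" "v = ?w s" by auto
    have "norm v \<le> norm (DG (x s)) * norm (g s)" by (simp add: s(2) Cauchy_Schwarz_ineq2)
    also have "\<dots> \<le> C' * C" using C C' s(1) by (intro mult_mono) auto
    finally show "norm v \<le> C' * C" .
  qed
  have "g absolutely_integrable_on ?I"
    using C by (intro absolutely_integrable_integrable_bound[where g="\<lambda>_. C"] primitive_onD(1)[OF x]) auto
  moreover have "(\<lambda>s. DG (x s)) \<in> borel_measurable (lebesgue_on ?I)"
    using Dc by (intro continuous_imp_measurable_on_sets_lebesgue) auto
  ultimately have "?w absolutely_integrable_on ?I"
    using Db absolutely_integrable_bounded_measurable_product[of "(\<bullet>)" "\<lambda>s. DG (x s)" ?I g]
    by (simp add: bilinear_conv_bounded_bilinear bounded_bilinear_inner)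
  then have wi: "?w integrable_on ?I" by (simp add: absolutely_integrable_on_def)
  have wi': "?w integrable_on {r..s}" if "p \<le> r" "s \<le> q" for r s
    using integrable_on_subinterval[OF wi, of r s] that by auto
  have gi': "g integrable_on {r..s}" if "p \<le> r" "s \<le> q" for r s
    by (rule primitive_onD(1)[OF primitive_on_subinterval[OF x that]])
  define h where "h s = G (x s) - integral {p..s} ?w" for s
  have "(h has_derivative (\<lambda>_. 0)) (at s within ?I)" if s: "s \<in> ?I" for s
    unfolding has_derivative_within_alt
  proof (intro conjI allI impI)
    show "bounded_linear (\<lambda>_::real. 0::real)" by (rule bounded_linear_zero)
    fix e :: real assume e: "0 < e"
    \<comment> \<open>Two errors arise, the first-order remainder of \<open>G\<close> and the
      oscillation of \<open>DG\<close> along \<open>x\<close>. Each will be at most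
      \<open>e' * C * \<bar>r - s\<bar>\<close>, hence the factor 2.\<close>
    define e' where "e' = e / (2 * C)"
    have e': "e' > 0" using e C by (simp add: e'_def)
    obtain d1 where d1: "d1 > 0"
      "\<And>y. norm (y - x s) < d1 \<Longrightarrow> norm (G y - G (x s) - DG (x s) \<bullet> (y - x s)) \<le> e' * norm (y - x s)"
      using G[of "x s"] e' unfolding has_derivative_at_alt by meson
    have "continuous (at s within ?I) x" "continuous (at s within ?I) (\<lambda>s. DG (x s))"
      using xc Dc s by (auto simp: continuous_on_eq_continuous_within)
    then have "\<exists>d>0. \<forall>r\<in>?I. dist r s < d \<longrightarrow> dist (x r) (x s) < d1"
      "\<exists>d>0. \<forall>r\<in>?I. dist r s < d \<longrightarrow> dist (DG (x r)) (DG (x s)) < e'"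
      using d1(1) e' by (simp_all add: continuous_within_eps_delta)
    then obtain d2 d3 where d2: "d2 > 0" "\<And>r. r \<in> ?I \<Longrightarrow> dist r s < d2 \<Longrightarrow> dist (x r) (x s) < d1"
      and d3: "d3 > 0" "\<And>r. r \<in> ?I \<Longrightarrow> dist r s < d3 \<Longrightarrow> dist (DG (x r)) (DG (x s)) < e'"
      by blast
    have key: "\<bar>h r - h s\<bar> \<le> e * \<bar>r - s\<bar>" if r: "r \<in> ?I" and d: "\<bar>r - s\<bar> < min d2 d3" for r
    proof -
      \<comment> \<open>Sorting the two times treats increments to the left and to the right of
        \<open>s\<close> together; only a sign in the final combination depends on the side.\<close>
      define u v where "u = min r s" and "v = max r s"
      have uv: "u \<le> v" "p \<le> u" "v \<le> q" "v - u = \<bar>r - s\<bar>" using r s by (auto simp: u_def v_def)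
      have inc: "x v - x u = integral {u..v} g"
        using primitive_on_increment[OF x] uv by auto
      have "norm (x v - x u) \<le> C * (v - u)"
        unfolding inc using uv C by (intro norm_integral_le_const gi') auto
      then have xr: "norm (x r - x s) \<le> C * (v - u)"
        by (cases "r \<le> s") (auto simp: u_def v_def norm_minus_commute)
      have 1: "\<bar>G (x r) - G (x s) - DG (x s) \<bullet> (x r - x s)\<bar> \<le> e' * (C * (v - u))"
      proof -
        have "dist (x r) (x s) < d1" using d2(2) r d by (simp add: dist_real_def)
        then have "\<bar>G (x r) - G (x s) - DG (x s) \<bullet> (x r - x s)\<bar> \<le> e' * norm (x r - x s)"
          using d1(2)[of "x r"] by (simp add: dist_norm)
        also have "\<dots> \<le> e' * (C * (v - u))" using xr e' by (intro mult_left_mono) auto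
        finally show ?thesis .
      qed
      have "((\<lambda>t. DG (x s) \<bullet> g t) has_integral DG (x s) \<bullet> (x v - x u)) {u..v}"
        unfolding inc using has_integral_linear[OF integrable_integral[OF gi'[of u v]], of "\<lambda>y. DG (x s) \<bullet> y"]
          uv by (simp add: o_def bounded_linear_inner_right)
      then have di: "((\<lambda>t. ?w t - DG (x s) \<bullet> g t) has_integral
          integral {u..v} ?w - DG (x s) \<bullet> (x v - x u)) {u..v}"
        using uv by (intro has_integral_diff integrable_integral wi') auto
      have 2: "\<bar>integral {u..v} ?w - DG (x s) \<bullet> (x v - x u)\<bar> \<le> (e' * C) * (v - u)"
      proof -
        have "norm (integral {u..v} (\<lambda>t. ?w t - DG (x s) \<bullet> g t)) \<le> (e' * C) * (v - u)"
        proof (rule norm_integral_le_const)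
          show "u \<le> v" by (rule uv)
          show "(\<lambda>t. ?w t - DG (x s) \<bullet> g t) integrable_on {u..v}" using di by blast
          fix t assume t: "t \<in> {u..v}"
          then have tI: "t \<in> ?I" "\<bar>t - s\<bar> \<le> \<bar>r - s\<bar>" using uv by (auto simp: u_def v_def)
          have "norm (?w t - DG (x s) \<bullet> g t) = \<bar>(DG (x t) - DG (x s)) \<bullet> g t\<bar>"
            by (simp add: inner_diff_left)
          also have "\<dots> \<le> norm (DG (x t) - DG (x s)) * norm (g t)" by (rule Cauchy_Schwarz_ineq2)
          also have "\<dots> \<le> e' * C"
            using d3(2)[OF tI(1)] tI d C(2)[OF tI(1)] e' by (intro mult_mono) (auto simp: dist_norm)
          finally show "norm (?w t - DG (x s) \<bullet> g t) \<le> e' * C" .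
        qed
        then show ?thesis using di by (simp add: integral_unique)
      qed
      have comb: "integral {p..v} ?w = integral {p..u} ?w + integral {u..v} ?w"
        using Henstock_Kurzweil_Integration.integral_combine[OF uv(2,1) wi'[of p v]] uv by simp
      have "\<bar>h r - h s\<bar> = \<bar>(G (x r) - G (x s) - DG (x s) \<bullet> (x r - x s)) -
          (if r \<le> s then -1 else 1) * (integral {u..v} ?w - DG (x s) \<bullet> (x v - x u))\<bar>"
        using comb by (cases "r \<le> s") (auto simp: h_def u_def v_def inner_diff_right)
      also have "\<dots> \<le> 2 * (e' * C * (v - u))"
        using 1 2 by (cases "r \<le> s") auto
      also have "\<dots> = e * \<bar>r - s\<bar>" using C uv by (simp add: e'_def field_simps)
      finally show ?thesis .
    qed
    show "\<exists>d>0. \<forall>y\<in>?I. norm (y - s) < d \<longrightarrow> norm (h y - h s - 0) \<le> e * norm (y - s)"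
      using d2(1) d3(1) key by (intro exI[of _ "min d2 d3"]) auto
  qed
  then obtain k where k: "\<And>s. s \<in> ?I \<Longrightarrow> h s = k"
    using has_derivative_zero_constant[of ?I h] by auto
  have "G (x s) = G (x p) + integral {p..s} ?w" if "s \<in> ?I" for s
    using k[OF that] k[of p] that by (auto simp: h_def)
  then show ?thesis by (intro primitive_onI wi wb)
qed

text \<open>The times in \<open>{r..q}\<close> at which \<open>u\<close> is at most \<open>A\<close>
  form a nonempty compact set, and its maximum is the wanted time. This isolates a final stretch on
  which a threshold is exceeded.\<close>

lemma last_time_below:
  fixes u :: "real \<Rightarrow> real"
  assumes u: "continuous_on {p..q} u" and r: "r \<in> {p..q}" "u r \<le> A" and "A < u q"
  shows "\<exists>s\<in>{r..<q}. u s \<le> A \<and> (\<forall>t\<in>{s<..q}. A < u t)"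
proof -
  let ?S = "{t \<in> {r..q}. u t \<le> A}"
  have "continuous_on {r..q} u" using r by (auto intro: continuous_on_subset[OF u])
  then have "closed ({r..q} \<inter> u -` {..A})" by (intro continuous_closed_preimage) auto
  also have "{r..q} \<inter> u -` {..A} = ?S" by auto
  finally have "closed ?S" .
  moreover have "bounded ?S" by (rule bounded_subset[of "{r..q}"]) auto
  ultimately have "compact ?S" by (simp add: compact_eq_bounded_closed)
  moreover have "?S \<noteq> {}" using r by auto
  ultimately obtain s where s: "s \<in> ?S" "\<And>t. t \<in> ?S \<Longrightarrow> t \<le> s"
    using compact_attains_sup[of ?S] by blast
  have "s < q" using s(1) assms(4) by (cases "s = q") auto
  moreover have "A < u t" if "t \<in> {s<..q}" for t
    using s(2)[of t] that s(1) by force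
  ultimately show ?thesis using s(1) by auto
qed

section \<open>Class K-infinity functions and integral equations\<close>

text \<open>Extended by the identity to negative arguments, \<open>\<alpha>\<close> becomes an
  increasing bijection of the real line. Its inverse is increasing and onto, and therefore
  continuous.\<close>

lemma class_Kinf_inverse:
  assumes "class_Kinf \<alpha>"
  shows "\<exists>\<beta>. class_Kinf \<beta> \<and> (\<forall>s\<ge>0. \<beta> s \<ge> 0 \<and> \<alpha> (\<beta> s) = s)"
proof -
  have \<alpha>: "continuous_on {0..} \<alpha>" "\<alpha> 0 = 0" "strict_mono_on {0..} \<alpha>" "filterlim \<alpha> at_top at_top"
    using assms by (auto simp: class_Kinf_def class_K_def)
  define A where "A s = (if s < 0 then s else \<alpha> s)" for s
  have nonneg: "\<alpha> s \<ge> 0" if "s \<ge> 0" for s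
    using \<alpha>(2) strict_mono_on_leD[OF \<alpha>(3), of 0 s] that by auto
  have less: "A s < A t" if "s < t" for s t
    using strict_mono_onD[OF \<alpha>(3), of s t] nonneg[of t] that by (auto simp: A_def)
  have surj: "\<exists>s. A s = y" for y
  proof (cases "y < 0")
    case False
    obtain M where M: "\<And>s. s \<ge> M \<Longrightarrow> \<alpha> s \<ge> y"
      using \<alpha>(4) by (auto simp: filterlim_at_top eventually_at_top_linorder)
    have "\<exists>s\<ge>0. s \<le> max M 0 \<and> \<alpha> s = y"
      using False \<alpha>(2) M[of "max M 0"] by (intro IVT') (auto intro: continuous_on_subset[OF \<alpha>(1)])
    then obtain s where "s \<ge> 0" "\<alpha> s = y" by auto
    then show ?thesis by (intro exI[of _ s]) (simp add: A_def)
  qed (auto simp: A_def)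
  define \<beta> where "\<beta> = inv A"
  have A\<beta>: "A (\<beta> y) = y" for y using surj surj_f_inv_f[of A y] by (metis \<beta>_def surjI)
  have less': "\<beta> y < \<beta> y'" if "y < y'" for y y'
    using less[of "\<beta> y'" "\<beta> y"] A\<beta>[of y] A\<beta>[of y'] that by (metis linorder_neq_iff order_less_asym)
  have \<beta>A: "\<beta> (A s) = s" for s
    using less[of s "\<beta> (A s)"] less[of "\<beta> (A s)" s] A\<beta>[of "A s"] by (metis linorder_neq_iff)
  have nn: "\<beta> s \<ge> 0" if "s \<ge> 0" for s
  proof (rule ccontr)
    assume "\<not> \<beta> s \<ge> 0"
    then have "A (\<beta> s) < 0" by (simp add: A_def)
    then show False using A\<beta>[of s] that by simp
  qed
  have "surj \<beta>" using \<beta>A by (metis surjI)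
  then have "continuous_on UNIV \<beta>"
    using less' by (intro continuous_onI_mono) (auto simp: le_less)
  moreover have "\<beta> 0 = 0" using \<beta>A[of 0] \<alpha>(2) by (simp add: A_def)
  moreover have "strict_mono_on {0..} \<beta>" using less' by (auto intro: strict_mono_onI)
  moreover have "filterlim \<beta> at_top at_top"
    unfolding filterlim_at_top eventually_at_top_linorder
  proof (intro allI exI impI)
    fix Z y assume "A Z \<le> y"
    then have "\<beta> (A Z) \<le> \<beta> y" using less'[of "A Z" y] by (cases "A Z = y") auto
    then show "Z \<le> \<beta> y" by (simp add: \<beta>A)
  qed
  ultimately have "class_Kinf \<beta>"
    by (auto simp: class_Kinf_def class_K_def intro: continuous_on_subset)
  moreover have "\<alpha> (\<beta> s) = s" if "s \<ge> 0" for s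
    using A\<beta>[of s] nn[OF that] by (simp add: A_def)
  ultimately show ?thesis using nn by blast
qed

lemma class_Kinf_nonneg: "class_Kinf \<alpha> \<Longrightarrow> s \<ge> 0 \<Longrightarrow> \<alpha> s \<ge> 0"
  using strict_mono_on_leD[of "{0..}" \<alpha> 0 s] by (auto simp: class_Kinf_def class_K_def)

lemma class_Kinf_pos: "class_Kinf \<alpha> \<Longrightarrow> s > 0 \<Longrightarrow> \<alpha> s > 0"
  using strict_mono_onD[of "{0..}" \<alpha> 0 s] by (auto simp: class_Kinf_def class_K_def)

lemma class_Kinf_mono: "class_Kinf \<alpha> \<Longrightarrow> 0 \<le> s \<Longrightarrow> s \<le> t \<Longrightarrow> \<alpha> s \<le> \<alpha> t"
  using strict_mono_on_leD[of "{0..}" \<alpha> s t] by (auto simp: class_Kinf_def class_K_def)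

lemma class_Kinf_continuous: "class_Kinf \<alpha> \<Longrightarrow> continuous_on {0..} \<alpha>"
  by (auto simp: class_Kinf_def class_K_def)

lemma class_Kinf_rescale:
  assumes "class_Kinf \<alpha>" "k > 0"
  shows "class_Kinf (\<lambda>s. \<alpha> (k * s))"
proof -
  have "continuous_on {0..} (\<lambda>s. \<alpha> (k * s))"
    using assms by (intro continuous_on_compose2[OF class_Kinf_continuous[OF assms(1)]] continuous_intros) auto
  moreover have "strict_mono_on {0..} (\<lambda>s. \<alpha> (k * s))"
    using assms by (auto simp: class_Kinf_def class_K_def strict_mono_on_def)
  moreover have "filterlim (\<lambda>s. \<alpha> (k * s)) at_top at_top"
    using assms by (intro filterlim_compose[of \<alpha> at_top at_top "\<lambda>s. k * s"]
        filterlim_tendsto_pos_mult_at_top[OF tendsto_const]) (auto simp: class_Kinf_def filterlim_ident)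
  ultimately show ?thesis using assms by (simp add: class_Kinf_def class_K_def)
qed

section \<open>Gronwall's inequality and Picard iteration\<close>

text \<open>Gronwall's argument with zero initial value: the integral of \<open>h\<close>, weighted
  by \<open>exp (- L * s)\<close>, is nonincreasing and starts at zero, so it cannot be
  positive.\<close>

lemma integral_le_imp_zero:
  fixes h :: "real \<Rightarrow> real"
  assumes h: "continuous_on {0..T} h" "\<And>t. t \<in> {0..T} \<Longrightarrow> 0 \<le> h t" and L: "L \<ge> 0"
    and le: "\<And>t. t \<in> {0..T} \<Longrightarrow> h t \<le> L * integral {0..t} h" and t: "t \<in> {0..T}"
  shows "h t = 0"
proof -
  define H where "H s = exp (- L * s) * integral {0..s} h" for s
  have hi: "(h has_integral integral {0..t} h) {0..t}" if "t \<in> {0..T}" for t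
    using that continuous_on_subset[OF h(1), of "{0..t}"] by (auto intro!: integrable_integral integrable_continuous_real)
  have nonneg: "integral {0..t} h \<ge> 0"
    using t h(2) by (intro integral_nonneg) (auto intro!: has_integral_integrable[OF hi[OF t]])
  have "H t \<le> H 0"
  proof (rule DERIV_nonpos_imp_decreasing_open[of 0 t H])
    show "0 \<le> t" using t by auto
    fix s assume s: "0 < s" "s < t"
    have "((\<lambda>s. integral {0..s} h) has_vector_derivative h s) (at s within {0..T})"
      using s t by (intro integral_has_vector_derivative h) auto
    then have "((\<lambda>s. integral {0..s} h) has_real_derivative h s) (at s)"
      using s t at_within_Icc_at[of 0 s T] by (auto simp: has_real_derivative_iff_has_vector_derivative)
    then have "(H has_real_derivative exp (- L * s) * (h s - L * integral {0..s} h)) (at s)"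
      unfolding H_def by (auto intro!: derivative_eq_intros simp: algebra_simps)
    moreover have "exp (- L * s) * (h s - L * integral {0..s} h) \<le> 0"
      using le[of s] s t by (intro mult_nonneg_nonpos) auto
    ultimately show "\<exists>y. (H has_real_derivative y) (at s) \<and> y \<le> 0" by blast
  next
    show "continuous_on {0..t} H" unfolding H_def
      using t has_integral_integrable[OF hi[OF t]]
      by (intro continuous_intros indefinite_integral_continuous_1) auto
  qed
  then have "integral {0..t} h \<le> 0" by (simp add: H_def mult_le_0_iff)
  then have "h t \<le> 0" using le[OF t] nonneg by simp
  then show ?thesis using h(2)[OF t] by simp
qed

text \<open>The weight \<open>exp (- 2 * L * t)\<close> makes the Picard operator a contraction on the whole half line.\<close>

lemma Picard_global:
  fixes F :: "real \<Rightarrow> 'b::euclidean_space \<Rightarrow> 'b"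
  assumes bnd: "\<And>t x. t \<ge> 0 \<Longrightarrow> norm (F t x) \<le> C"
    and lip: "\<And>t x y. t \<ge> 0 \<Longrightarrow> norm (F t x - F t y) \<le> L * norm (x - y)"
    and int: "\<And>x t. continuous_on UNIV x \<Longrightarrow> t \<ge> 0 \<Longrightarrow> (\<lambda>s. F s (x s)) integrable_on {0..t}"
    and L: "L > 0"
  obtains x where "continuous_on UNIV x" "\<And>t. t \<ge> 0 \<Longrightarrow> x t = x0 + integral {0..t} (\<lambda>s. F s (x s))"
proof -
  have C: "C \<ge> 0" using order_trans[OF norm_ge_zero bnd[of 0 0]] by simp
  \<comment> \<open>The unknown \<open>u\<close> is the weighted trajectory, which is bounded and so
    lives in a complete space; \<open>X u\<close> removes the weight.\<close>
  define X where "X u s = exp (2 * L * s) *\<^sub>R apply_bcontfun u s" for u :: "real \<Rightarrow>\<^sub>C 'b" and s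
  have Xc: "continuous_on UNIV (X u)" for u unfolding X_def by (intro continuous_intros) auto
  \<comment> \<open>Bounded continuous functions are taken on the whole line, so the image is
    continued to negative times by its value at 0.\<close>
  define P where "P u t = exp (- 2 * L * max 0 t) *\<^sub>R (x0 + integral {0..max 0 t} (\<lambda>s. F s (X u s)))"
    for u :: "real \<Rightarrow>\<^sub>C 'b" and t
  have I: "(\<lambda>s. F s (X u s)) integrable_on {0..t}" if "t \<ge> 0" for u t
    using int[OF Xc that] .
  have c0: "continuous_on {0..} (\<lambda>t. integral {0..t} (\<lambda>s. F s (X u s)))" for u
  proof -
    have "continuous (at t within {0..}) (\<lambda>t. integral {0..t} (\<lambda>s. F s (X u s)))" if "t \<ge> 0" for t
    proof -
      have "continuous_on {0..t+1} (\<lambda>t. integral {0..t} (\<lambda>s. F s (X u s)))"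
        using that by (intro indefinite_integral_continuous_1 I) auto
      then have "continuous (at t within {0..t+1}) (\<lambda>t. integral {0..t} (\<lambda>s. F s (X u s)))"
        using that by (auto simp: continuous_on_eq_continuous_within)
      moreover have "at t within {0..t+1} = at t within {0..}"
        by (rule at_within_nhd[of _ "{..<t+1}"]) auto
      ultimately show ?thesis by simp
    qed
    then show ?thesis by (auto simp: continuous_on_eq_continuous_within)
  qed
  have Pc: "continuous_on UNIV (P u)" for u
    unfolding P_def
    by (intro continuous_intros continuous_on_compose2[OF c0]) auto
  \<comment> \<open>A bounded \<open>F\<close> gives at most linear growth of the integral, and this
    estimate shows that the weight keeps it bounded.\<close>
  have lin: "exp (- 2 * L * t) * t \<le> 1 / L" if "t \<ge> 0" for t
  proof -
    have "L * t \<le> exp (2 * L * t)"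
      using exp_ge_add_one_self[of "2 * L * t"] that L mult_nonneg_nonneg[of L t] by linarith
    then show ?thesis using L by (simp add: exp_minus field_simps)
  qed
  have Pb: "P u \<in> bcontfun" for u
  proof (rule bcontfun_normI[OF Pc])
    fix t :: real
    define r where "r = max 0 t"
    have r: "r \<ge> 0" by (simp add: r_def)
    have "norm (P u t) = exp (- 2 * L * r) * norm (x0 + integral {0..r} (\<lambda>s. F s (X u s)))"
      by (simp add: P_def r_def)
    also have "norm (x0 + integral {0..r} (\<lambda>s. F s (X u s))) \<le> norm x0 + C * (r - 0)"
      using r bnd by (intro norm_triangle_mono norm_integral_le_const I) auto
    also have "exp (- 2 * L * r) * (norm x0 + C * (r - 0)) = exp (- 2 * L * r) * norm x0 + C * (exp (- 2 * L * r) * r)"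
      by (simp add: algebra_simps)
    also have "\<dots> \<le> 1 * norm x0 + C * (1 / L)"
      using lin[OF r] r L C by (intro add_mono mult_mono mult_left_mono) auto
    finally show "norm (P u t) \<le> 1 * norm x0 + C * (1 / L)" by simp
  qed
  define Q where "Q u = Bcontfun (P u)" for u
  have Q: "apply_bcontfun (Q u) = P u" for u
    unfolding Q_def by (rule Bcontfun_inverse[OF Pb])
  have contr: "dist (Q u) (Q v) \<le> 1/2 * dist u v" for u v
  proof (rule dist_bound)
    fix t :: real
    define r where "r = max 0 t"
    have r: "r \<ge> 0" by (simp add: r_def)
    \<comment> \<open>The integrands differ by at most \<open>?d s\<close> at time \<open>s\<close>.
      Its integral is below \<open>exp (2 * L * r) * dist u v / 2\<close>: the exponent
      \<open>2 * L\<close> is what produces the contraction factor 1/2.\<close>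
    let ?d = "\<lambda>s. L * (exp (2 * L * s) * dist u v)"
    have di: "(?d has_integral (exp (2 * L * r) * dist u v / 2 - exp (2 * L * 0) * dist u v / 2)) {0..r}"
      using r L by (intro fundamental_theorem_of_calculus)
        (auto simp: has_real_derivative_iff_has_vector_derivative[symmetric] intro!: derivative_eq_intros)
    have "norm (integral {0..r} (\<lambda>s. F s (X u s) - F s (X v s))) \<le> integral {0..r} ?d"
    proof (rule integral_norm_bound_integral)
      show "?d integrable_on {0..r}" using di by blast
      show "(\<lambda>s. F s (X u s) - F s (X v s)) integrable_on {0..r}"
        by (intro integrable_diff I r)
      fix s assume s: "s \<in> {0..r}"
      have "norm (F s (X u s) - F s (X v s)) \<le> L * norm (X u s - X v s)" using lip s by auto
      also have "norm (X u s - X v s) = exp (2 * L * s) * dist (apply_bcontfun u s) (apply_bcontfun v s)"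
        by (simp add: X_def dist_norm flip: scaleR_diff_right)
      also have "L * \<dots> \<le> ?d s"
        using L dist_bounded[of u s v] by (intro mult_left_mono) auto
      finally show "norm (F s (X u s) - F s (X v s)) \<le> ?d s" .
    qed
    also have "\<dots> \<le> exp (2 * L * r) * dist u v / 2" unfolding integral_unique[OF di] by simp
    finally have 1: "norm (integral {0..r} (\<lambda>s. F s (X u s)) - integral {0..r} (\<lambda>s. F s (X v s)))
        \<le> exp (2 * L * r) * dist u v / 2"
      using I r by (simp add: integral_diff)
    have "dist (Q u t) (Q v t) = exp (- 2 * L * r) *
        norm (integral {0..r} (\<lambda>s. F s (X u s)) - integral {0..r} (\<lambda>s. F s (X v s)))"
      by (simp add: Q P_def dist_norm r_def flip: scaleR_diff_right)
    also have "\<dots> \<le> exp (- 2 * L * r) * (exp (2 * L * r) * dist u v / 2)"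
      by (intro mult_left_mono 1) auto
    also have "\<dots> = 1/2 * dist u v" by (simp add: exp_minus)
    finally show "dist (Q u t) (Q v t) \<le> 1/2 * dist u v" .
  qed
  then have "\<exists>!u. Q u = u" by (intro banach_fix_type[of "1/2"]) auto
  then obtain u where u: "Q u = u" by auto
  have "X u t = x0 + integral {0..t} (\<lambda>s. F s (X u s))" if "t \<ge> 0" for t
  proof -
    have "X u t = exp (2 * L * t) *\<^sub>R P u t" using u Q[of u] by (simp add: X_def)
    also have "\<dots> = x0 + integral {0..t} (\<lambda>s. F s (X u s))"
      using that by (simp add: P_def max_def exp_minus)
    finally show ?thesis .
  qed
  then show ?thesis using that[OF Xc] by blast
qed

text \<open>The average of \<open>r\<close> over \<open>[m, m + 1]\<close> dominates
  \<open>r m\<close> by monotonicity, and it is continuous in \<open>m\<close> as a difference of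
  two values of an indefinite integral.\<close>

lemma mono_continuous_majorant:
  fixes r :: "real \<Rightarrow> real"
  assumes r: "mono r"
  obtains R where "continuous_on UNIV R" "\<And>m. r m \<le> R m"
proof -
  have int: "r integrable_on {p..q}" for p q
    by (intro integrable_on_lebesgue_on integrable_mono_on monotone_on_subset[OF r]) auto
  define R where "R m = integral {m..m+1} r" for m
  have "r m \<le> R m" for m
  proof -
    have "integral {m..m+1} (\<lambda>_. r m) \<le> R m"
      unfolding R_def using r by (intro integral_le int) (auto simp: mono_def)
    then show ?thesis by simp
  qed
  moreover have "continuous_on UNIV R"
  proof -
    have "isCont R m" for m
    proof -
      let ?J = "\<lambda>x. integral {m-1..x} r"
      have c: "continuous_on {m-1..m+3} ?J" by (intro indefinite_integral_continuous_1 int)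
      have "continuous_on {m-1<..<m+1} (\<lambda>x. ?J (x + 1) - ?J x)"
        by (intro continuous_intros continuous_on_compose2[OF c]) auto
      moreover have "R x = ?J (x + 1) - ?J x" if "x \<in> {m-1<..<m+1}" for x
        using Henstock_Kurzweil_Integration.integral_combine[of "m-1" x "x+1" r] int that
        by (simp add: R_def)
      ultimately have "continuous_on {m-1<..<m+1} R"
        by (subst continuous_on_cong[OF refl]) auto
      then show ?thesis by (rule continuous_on_interior) (auto simp: interior_open)
    qed
    then show ?thesis by (simp add: continuous_on_eq_continuous_at)
  qed
  ultimately show ?thesis using that by blast
qed

section \<open>Scalar comparison\<close>

text \<open>The function \<open>exp (k * (s - p)) * \<Phi> (W s)\<close> has as its rate the left
  side of the hypothesis times a positive weight, so it does not increase.\<close>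

lemma exp_decay_of_primitive:
  fixes W w \<Phi> \<Phi>' :: "real \<Rightarrow> real"
  assumes W: "primitive_on p q W w" and pq: "p \<le> q" and N: "negligible N"
    and \<Phi>: "\<And>y. (\<Phi> has_real_derivative \<Phi>' y) (at y)" and \<Phi>'_cont: "continuous_on UNIV \<Phi>'"
    and le: "\<And>s. s \<in> {p..q} - N \<Longrightarrow> k * \<Phi> (W s) + \<Phi>' (W s) * w s \<le> 0"
  shows "\<Phi> (W q) \<le> exp (- k * (q - p)) * \<Phi> (W p)"
proof -
  define G where "G y = exp (k * (fst y - p)) * \<Phi> (snd y)" for y :: "real \<times> real"
  define DG where "DG y = (k * exp (k * (fst y - p)) * \<Phi> (snd y), exp (k * (fst y - p)) * \<Phi>' (snd y))"
    for y :: "real \<times> real"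
  \<comment> \<open>Time itself is a primitive of 1; pairing it with \<open>W\<close> brings the
    exponential weight within reach of the autonomous chain rule.\<close>
  have time: "primitive_on p q (\<lambda>s. s) (\<lambda>s. 1::real)"
    by (rule primitive_onI) (auto simp: image_constant_conv)
  have \<Phi>c: "continuous_on UNIV \<Phi>"
    using \<Phi> by (meson DERIV_isCont continuous_at_imp_continuous_on)
  have "(G has_derivative (\<lambda>h. DG y \<bullet> h)) (at y)" for y
    unfolding G_def DG_def
    by (auto intro!: derivative_eq_intros DERIV_compose_FDERIV[OF \<Phi>] simp: inner_prod_def algebra_simps)
  moreover have "continuous_on UNIV DG"
    unfolding DG_def
    by (intro continuous_intros continuous_on_compose2[OF \<Phi>c] continuous_on_compose2[OF \<Phi>'_cont]) auto
  ultimately have *: "primitive_on p q (\<lambda>s. G (s, W s)) (\<lambda>s. DG (s, W s) \<bullet> (1, w s))"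
    using primitive_on_compose[OF primitive_on_Pair[OF time W]] by blast
  have "DG (s, W s) \<bullet> (1, w s) \<le> 0" if "s \<in> {p..q} - N" for s
  proof -
    have "DG (s, W s) \<bullet> (1, w s) = exp (k * (s - p)) * (k * \<Phi> (W s) + \<Phi>' (W s) * w s)"
      by (simp add: DG_def inner_prod_def algebra_simps)
    then show ?thesis using le[OF that] by (simp add: mult_le_0_iff)
  qed
  then have "G (q, W q) \<le> G (p, W p)"
    using primitive_on_mono[OF * pq N, of 0] by simp
  then have "exp (k * (q - p)) * \<Phi> (W q) \<le> \<Phi> (W p)"
    by (simp add: G_def)
  moreover have "exp (- k * (q - p)) = 1 / exp (k * (q - p))" by (simp add: exp_minus inverse_eq_divide)
  ultimately show ?thesis by (simp add: pos_le_divide_eq mult.commute)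
qed

text \<open>An interface for the scalar comparison: the general gain and the explicit linear one
  enter the later arguments in the same way. The start time is arbitrary, so that trajectories can
  be restarted late.\<close>

definition comparison_pair :: "(real \<Rightarrow> real) \<Rightarrow> (real \<Rightarrow> real \<Rightarrow> real) \<Rightarrow> (real \<Rightarrow> real) \<Rightarrow> bool" where
  "comparison_pair \<rho> \<sigma> \<gamma> \<longleftrightarrow>
     (\<forall>p q W w X N. p \<le> q \<longrightarrow> primitive_on p q W w \<longrightarrow> (\<forall>s\<in>{p..q}. 0 \<le> W s) \<longrightarrow> negligible N \<longrightarrow> 0 \<le> X \<longrightarrow>
        (\<forall>s\<in>{p..q} - N. w s \<le> - \<rho> (W s) + X) \<longrightarrow> W q \<le> \<sigma> (W p) (q - p) + \<gamma> X)"

lemma comparison_pairD: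
  assumes "comparison_pair \<rho> \<sigma> \<gamma>" "primitive_on p q W w" "p \<le> q" "\<And>s. s \<in> {p..q} \<Longrightarrow> 0 \<le> W s"
    "negligible N" "0 \<le> X" "\<And>s. s \<in> {p..q} - N \<Longrightarrow> w s \<le> - \<rho> (W s) + X"
  shows "W q \<le> \<sigma> (W p) (q - p) + \<gamma> X"
  by (rule assms(1)[unfolded comparison_pair_def, rule_format, OF assms(3,2,4-7)])

text \<open>The shifted quantity \<open>W - X / c\<close> decays exponentially at rate
  \<open>c\<close>.\<close>

lemma comparison_pair_linear:
  assumes c: "c > 0" and \<rho>: "\<And>s. s \<ge> 0 \<Longrightarrow> c * s \<le> \<rho> s"
  shows "comparison_pair \<rho> (\<lambda>s t. exp (- c * t) * s) (\<lambda>s. s / c)"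
  unfolding comparison_pair_def
proof (intro allI impI)
  fix p q X :: real and W w :: "real \<Rightarrow> real" and N
  assume pq: "p \<le> q" and W: "primitive_on p q W w" "\<forall>s\<in>{p..q}. 0 \<le> W s" "negligible N" "0 \<le> X"
    and le: "\<forall>s\<in>{p..q} - N. w s \<le> - \<rho> (W s) + X"
  have "W q - X / c \<le> exp (- c * (q - p)) * (W p - X / c)"
  proof (rule exp_decay_of_primitive[OF W(1) pq W(3), where \<Phi>' = "\<lambda>_. 1"])
    fix s assume s: "s \<in> {p..q} - N"
    have "w s \<le> - \<rho> (W s) + X" "c * W s \<le> \<rho> (W s)" using le W(2) \<rho> s by auto
    then show "c * (W s - X / c) + 1 * w s \<le> 0" using c by (simp add: algebra_simps)
  qed (auto intro!: derivative_eq_intros)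
  also have "\<dots> \<le> exp (- c * (q - p)) * W p" using c W(4) by (intro mult_left_mono) auto
  finally show "W q \<le> exp (- c * (q - p)) * W p + X / c" by simp
qed

text \<open>The function \<open>s * exp (s / \<delta>)\<close> linearises the saturated decay rate \<open>min s \<delta>\<close>: its derivative
  times \<open>min s \<delta>\<close> dominates it.\<close>

lemma comparison_pair_saturated:
  assumes \<rho>: "class_Kinf \<rho>" and c: "c > 0" and \<delta>: "\<delta> > 0"
    and lin: "\<And>s. 0 \<le> s \<Longrightarrow> s \<le> \<delta> \<Longrightarrow> c * s \<le> \<rho> s"
    and \<beta>: "\<And>s. s \<ge> 0 \<Longrightarrow> \<beta> s \<ge> 0" "\<And>s. s \<ge> 0 \<Longrightarrow> \<rho> (\<beta> s) = s"
  shows "comparison_pair \<rho> (\<lambda>s t. exp (- (c / 2) * t) * (s * exp (s / \<delta>))) (\<lambda>s. \<beta> (2 * s))"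
  unfolding comparison_pair_def
proof (intro allI impI)
  fix p q X :: real and W w :: "real \<Rightarrow> real" and N
  assume pq: "p \<le> q" and W: "primitive_on p q W w" "\<forall>s\<in>{p..q}. 0 \<le> W s" and N: "negligible N"
    and X: "0 \<le> X" and le: "\<forall>s\<in>{p..q} - N. w s \<le> - \<rho> (W s) + X"
  \<comment> \<open>Above this level \<open>\<rho> (W s)\<close> is at least \<open>2 * X\<close>,
    so half of the decay survives after the input has been paid for.\<close>
  let ?A = "\<beta> (2 * X)"
  have A: "?A \<ge> 0" "\<rho> ?A = 2 * X" using \<beta> X by auto
  \<comment> \<open>Linear growth is known only up to \<open>\<delta>\<close>; beyond it,
    monotonicity of \<open>\<rho>\<close> preserves the value reached at
    \<open>\<delta>\<close>.\<close>
  have sat: "c * min s \<delta> \<le> \<rho> s" if "s \<ge> 0" for s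
    using lin[of s] lin[of \<delta>] class_Kinf_mono[OF \<rho>, of \<delta> s] that \<delta> by (auto simp: min_def)
  have big: "w s \<le> - (\<rho> (W s) / 2)" if "s \<in> {p..q} - N" "?A \<le> W s" for s
  proof -
    have "2 * X \<le> \<rho> (W s)" using class_Kinf_mono[OF \<rho> A(1) that(2)] A(2) by simp
    moreover have "w s \<le> - \<rho> (W s) + X" using le that(1) by blast
    ultimately show ?thesis by simp
  qed
  have nn: "0 \<le> exp (- (c / 2) * (q - p)) * (W p * exp (W p / \<delta>))" using W(2) pq by simp
  show "W q \<le> exp (- (c / 2) * (q - p)) * (W p * exp (W p / \<delta>)) + ?A"
  proof (cases "W q \<le> ?A")
    case True
    then show ?thesis using nn by linarith
  next
    case False
    \<comment> \<open>A trajectory that ends above \<open>?A\<close> was above it all along: after a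
      last time at or below \<open>?A\<close> its rate is nonpositive, so it could not have
      risen.\<close>
    have above: "?A < W s" if s: "s \<in> {p..q}" for s
    proof (rule ccontr)
      assume "\<not> ?A < W s"
      then have s': "W s \<le> ?A" by simp
      have Wq: "?A < W q" using False by simp
      obtain r where r: "s \<le> r" "r < q" "W r \<le> ?A" "\<And>t. r < t \<Longrightarrow> t \<le> q \<Longrightarrow> ?A < W t"
        using last_time_below[OF primitive_on_continuous[OF W(1)] s s' Wq] by auto
      have "W q \<le> W r + 0 * (q - r)"
      proof (rule primitive_on_mono)
        show "primitive_on r q W w" using r s by (intro primitive_on_subinterval[OF W(1)]) auto
        show "negligible (insert r N)" using N by simp
        fix t assume t: "t \<in> {r..q} - insert r N"
        then have t': "t \<in> {p..q} - N" "?A \<le> W t" using r s by (auto intro: less_imp_le)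
        have "0 \<le> \<rho> (W t)" using class_Kinf_nonneg[OF \<rho>] W(2) t' by auto
        then show "w t \<le> 0" using big[OF t'] by simp
      qed (use r in auto)
      then show False using r False by simp
    qed
    have "W q * exp (W q / \<delta>) \<le> exp (- (c / 2) * (q - p)) * (W p * exp (W p / \<delta>))"
    proof (rule exp_decay_of_primitive[OF W(1) pq N, where \<Phi>' = "\<lambda>y. exp (y / \<delta>) * (1 + y / \<delta>)"])
      show "((\<lambda>y. y * exp (y / \<delta>)) has_real_derivative exp (y / \<delta>) * (1 + y / \<delta>)) (at y)" for y
        using \<delta> by (auto intro!: derivative_eq_intros simp: field_simps)
      show "continuous_on UNIV (\<lambda>y. exp (y / \<delta>) * (1 + y / \<delta>))"
        using \<delta> by (intro continuous_intros) auto
      fix s assume s: "s \<in> {p..q} - N"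
      then have Ws: "W s \<ge> 0" "?A \<le> W s" using W(2) above[of s] by auto
      define E Q m where "E = exp (W s / \<delta>)" and "Q = 1 + W s / \<delta>" and "m = min (W s) \<delta>"
      have "w s \<le> - (c * m / 2)" using big[OF s Ws(2)] sat[OF Ws(1)] by (simp add: m_def)
      then have "E * Q * w s \<le> E * Q * (- (c * m / 2))"
        using Ws \<delta> by (intro mult_left_mono) (auto simp: E_def Q_def)
      \<comment> \<open>Below \<open>\<delta>\<close> this uses \<open>Q \<ge> 1\<close>; above
        \<open>\<delta>\<close> the right side equals \<open>\<delta> + W s\<close>.\<close>
      moreover have "W s \<le> Q * m"
        using Ws \<delta> by (auto simp: Q_def m_def min_def algebra_simps)
      then have "c / 2 * E * W s \<le> c / 2 * E * (Q * m)"
        using c by (intro mult_left_mono) (auto simp: E_def)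
      ultimately have "c / 2 * (W s * E) + E * Q * w s \<le> 0"
        by (simp add: algebra_simps)
      then show "c / 2 * (W s * exp (W s / \<delta>)) + exp (W s / \<delta>) * (1 + W s / \<delta>) * w s \<le> 0"
        by (simp add: E_def Q_def)
    qed
    moreover have "W q * 1 \<le> W q * exp (W q / \<delta>)"
      using W(2) pq \<delta> by (intro mult_left_mono) auto
    ultimately show ?thesis using A by simp
  qed
qed

lemma tendsto_exp_decay:
  fixes k s :: real
  assumes "k > 0"
  shows "((\<lambda>t. exp (- k * t) * s) \<longlongrightarrow> 0) at_top"
proof -
  have "((\<lambda>t. exp (- (k * t))) \<longlongrightarrow> 0) at_top"
    using assms by (intro filterlim_compose[OF exp_at_bot] filterlim_compose[OF filterlim_uminus_at_bot_at_top]
        filterlim_tendsto_pos_mult_at_top[OF tendsto_const] filterlim_ident)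
  then show ?thesis by (simp add: tendsto_mult_left_zero)
qed

lemma class_KL_exp:
  assumes "k > 0" "\<delta> > 0"
  shows "class_KL (\<lambda>s t. exp (- k * t) * (s * exp (s / \<delta>)))"
  unfolding class_KL_def class_K_def
proof (intro conjI allI impI)
  show "continuous_on ({0..} \<times> {0..}) (\<lambda>(s, t). exp (- k * t) * (s * exp (s / \<delta>)))"
    using assms unfolding case_prod_unfold by (intro continuous_intros) auto
next
  fix t :: real
  show "continuous_on {0..} (\<lambda>s. exp (- k * t) * (s * exp (s / \<delta>)))"
    using assms by (intro continuous_intros) auto
  show "strict_mono_on {0..} (\<lambda>s. exp (- k * t) * (s * exp (s / \<delta>)))"
  proof (rule strict_mono_onI)
    fix r s :: real assume "r \<in> {0..}" "s \<in> {0..}" "r < s"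
    then have "r * exp (r / \<delta>) < s * exp (s / \<delta>)"
      using assms by (intro mult_strict_mono) (auto simp: divide_strict_right_mono)
    then show "exp (- k * t) * (r * exp (r / \<delta>)) < exp (- k * t) * (s * exp (s / \<delta>))" by simp
  qed
next
  fix s t1 t2 :: real assume "0 \<le> s" "0 \<le> t1" "t1 \<le> t2"
  then show "exp (- k * t2) * (s * exp (s / \<delta>)) \<le> exp (- k * t1) * (s * exp (s / \<delta>))"
    using assms by (intro mult_right_mono) auto
next
  fix s :: real
  show "((\<lambda>t. exp (- k * t) * (s * exp (s / \<delta>))) \<longlongrightarrow> 0) at_top"
    using assms(1) by (rule tendsto_exp_decay)
qed simp

section \<open>Essential suprema and Lipschitz estimates\<close>

lemma AE_lborel_imp_negligible:
  assumes "AE t in lborel. P t"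
  shows "negligible {t :: real. \<not> P t}"
proof -
  obtain N where "N \<in> null_sets lborel" "{t. \<not> P t} \<subseteq> N"
    using assms by (auto simp: eventually_ae_filter)
  then show ?thesis
    by (metis negligible_iff_null_sets negligible_subset null_sets_completionI)
qed

lemma negligible_norm_above_esssup:
  fixes u :: "real \<Rightarrow> 'b::real_normed_vector"
  assumes "esssup (restrict_space lborel {T..}) (\<lambda>t. ereal (norm (u t))) \<le> ereal m"
  shows "negligible {t \<in> {T..}. m < norm (u t)}"
proof -
  have "AE t in restrict_space lborel {T..}. ereal (norm (u t)) \<le> ereal m"
    using esssup_AE[of "\<lambda>t. ereal (norm (u t))" "restrict_space lborel {T..}"]
    by eventually_elim (use assms in order)
  then have "AE t in lborel. t \<in> {T..} \<longrightarrow> ereal (norm (u t)) \<le> ereal m"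
    by (subst (asm) AE_restrict_space_iff) auto
  from AE_lborel_imp_negligible[OF this] show ?thesis
    by (rule negligible_subset) auto
qed

text \<open>A negative essential supremum would be contradicted by the norm at almost every time,
  making the half line a null set, although it contains an interval of length 1.\<close>

lemma esssup_norm_nonneg:
  fixes u :: "real \<Rightarrow> 'b::real_normed_vector"
  shows "0 \<le> esssup (restrict_space lborel {T..}) (\<lambda>t. ereal (norm (u t)))"
proof (rule ccontr)
  assume neg: "\<not> ?thesis"
  have "AE t in restrict_space lborel {T..}. ereal (norm (u t)) \<le> esssup (restrict_space lborel {T..}) (\<lambda>t. ereal (norm (u t)))"
    by (rule esssup_AE)
  then have "AE t in restrict_space lborel {T..}. False"
  proof eventually_elim
    case (elim t)
    have "0 \<le> ereal (norm (u t))" by simp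
    with elim neg show False by order
  qed
  then have "AE t in lborel. \<not> t \<in> {T..}"
    by (subst (asm) AE_restrict_space_iff) auto
  from AE_lborel_imp_negligible[OF this] have "negligible {T..T+1}" by (rule negligible_subset) auto
  then show False using negligible_interval(1)[of T "T+1"] by (simp add: box_real)
qed

lemma Linf_input_ess_norm:
  assumes "Linf_input S u"
  shows "0 \<le> real_of_ereal (ess_norm u)" "negligible {t \<in> {0..}. real_of_ereal (ess_norm u) < norm (u t)}"
proof -
  have n: "0 \<le> ess_norm u" "ess_norm u < \<infinity>"
    using assms esssup_norm_nonneg by (auto simp: Linf_input_def ess_norm_def)
  then show "0 \<le> real_of_ereal (ess_norm u)" by (simp add: real_of_ereal_pos)
  have "ess_norm u = ereal (real_of_ereal (ess_norm u))" using n by (cases "ess_norm u") auto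
  then show "negligible {t \<in> {0..}. real_of_ereal (ess_norm u) < norm (u t)}"
    by (intro negligible_norm_above_esssup) (simp add: ess_norm_def)
qed

text \<open>The limit superior is a finite infimum of essential suprema over tails, so some tail
  exceeds it by less than \<open>\<eta>\<close>.\<close>

lemma Linf_input_ess_limsup_norm:
  assumes "Linf_input S u"
  shows "0 \<le> real_of_ereal (ess_limsup_norm u)"
    "\<eta> > 0 \<Longrightarrow> \<exists>T\<ge>0. negligible {t \<in> {T..}. real_of_ereal (ess_limsup_norm u) + \<eta> < norm (u t)}"
proof -
  have nn: "0 \<le> ess_limsup_norm u"
    unfolding ess_limsup_norm_def by (intro INF_greatest esssup_norm_nonneg)
  have "ess_limsup_norm u \<le> ess_norm u"
    unfolding ess_limsup_norm_def ess_norm_def by (rule INF_lower) simp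
  then have fin: "ess_limsup_norm u < \<infinity>" using assms by (auto simp: Linf_input_def)
  show "0 \<le> real_of_ereal (ess_limsup_norm u)" using nn by (simp add: real_of_ereal_pos)
  assume "\<eta> > 0"
  then have "ess_limsup_norm u < ereal (real_of_ereal (ess_limsup_norm u) + \<eta>)"
    using nn fin by (cases "ess_limsup_norm u") auto
  then obtain T where "T \<ge> 0"
    "esssup (restrict_space lborel {T..}) (\<lambda>t. ereal (norm (u t))) < ereal (real_of_ereal (ess_limsup_norm u) + \<eta>)"
    unfolding ess_limsup_norm_def by (auto simp: INF_less_iff)
  then show "\<exists>T\<ge>0. negligible {t \<in> {T..}. real_of_ereal (ess_limsup_norm u) + \<eta> < norm (u t)}"
    by (intro exI[of _ T] conjI negligible_norm_above_esssup) auto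
qed

section \<open>Lipschitz constants on compact sets\<close>

lemma lipschitz_on_cball_of_C1:
  fixes G :: "'b::euclidean_space \<Rightarrow> real"
  assumes G: "\<And>y. (G has_derivative (\<lambda>h. DG y \<bullet> h)) (at y)" and DG: "continuous_on UNIV DG"
  shows "\<exists>L\<ge>0. \<forall>x\<in>cball 0 r. \<forall>y\<in>cball 0 r. \<bar>G x - G y\<bar> \<le> L * norm (x - y)"
proof -
  have "compact (DG ` cball 0 r)"
    by (intro compact_continuous_image continuous_on_subset[OF DG]) auto
  then obtain L where L: "L > 0" "\<And>y. y \<in> cball 0 r \<Longrightarrow> norm (DG y) \<le> L"
    using compact_imp_bounded[of "DG ` cball 0 r"] by (auto simp: bounded_pos)
  show ?thesis
  proof (intro exI[of _ L] conjI ballI)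
    fix x y :: 'b assume xy: "x \<in> cball 0 r" "y \<in> cball 0 r"
    have "norm (G x - G y) \<le> L * norm (x - y)"
    proof (rule differentiable_bound[OF convex_cball _ _ xy])
      fix v :: 'b assume v: "v \<in> cball 0 r"
      show "(G has_derivative (\<lambda>h. DG v \<bullet> h)) (at v within cball 0 r)"
        by (rule has_derivative_at_withinI[OF G])
      show "onorm (\<lambda>h. DG v \<bullet> h) \<le> L"
      proof (rule onorm_bound)
        fix h show "norm (DG v \<bullet> h) \<le> L * norm h"
          using Cauchy_Schwarz_ineq2[of "DG v" h] mult_right_mono[OF L(2)[OF v], of "norm h"] by simp
      qed (use L in auto)
    qed
    then show "\<bar>G x - G y\<bar> \<le> L * norm (x - y)" by simp
  qed (use L in auto)
qed

text \<open>Nearby points share one ball of a finite subcover and its local constant applies. For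
  points at distance at least \<open>m\<close>, the uniform bound \<open>C\<close> divided by
  \<open>m\<close> serves as a Lipschitz constant.\<close>

lemma lipschitz_on_compact_of_local:
  fixes h :: "'i \<Rightarrow> 'x::metric_space \<Rightarrow> 'b::real_normed_vector"
  assumes K: "compact K"
    and loc: "\<And>x0. \<exists>e>0. \<exists>L. \<forall>x1\<in>ball x0 e. \<forall>x2\<in>ball x0 e. \<forall>i\<in>I. norm (h i x1 - h i x2) \<le> L * dist x1 x2"
    and bnd: "\<And>i x. i \<in> I \<Longrightarrow> x \<in> K \<Longrightarrow> norm (h i x) \<le> C"
  shows "\<exists>L\<ge>0. \<forall>x\<in>K. \<forall>y\<in>K. \<forall>i\<in>I. norm (h i x - h i y) \<le> L * dist x y"
proof -
  obtain e l where e: "\<And>x0. e x0 > 0" and l: "\<And>x0 x1 x2 i. x1 \<in> ball x0 (e x0) \<Longrightarrow> x2 \<in> ball x0 (e x0) \<Longrightarrow>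
      i \<in> I \<Longrightarrow> norm (h i x1 - h i x2) \<le> l x0 * dist x1 x2"
    using loc by metis
  have "K \<subseteq> (\<Union>x0\<in>K. ball x0 (e x0 / 2))" using e by auto
  then obtain F where F: "F \<subseteq> K" "finite F" "K \<subseteq> (\<Union>x0\<in>F. ball x0 (e x0 / 2))"
    using compactE_image[OF K, of K "\<lambda>x0. ball x0 (e x0 / 2)"] by auto
  \<comment> \<open>Half of the smallest radius in the cover: a point in a half ball and any point
    closer than \<open>m\<close> to it lie in the same full ball. Inserting 1 keeps the minimum
    meaningful when the cover is empty.\<close>
  define m where "m = Min (insert 1 ((\<lambda>x0. e x0 / 2) ` F))"
  have m: "m > 0" using F(2) e by (simp add: m_def)
  have m': "m \<le> e x0 / 2" if "x0 \<in> F" for x0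
    unfolding m_def using F(2) that by (intro Min_le) auto
  define L where "L = (\<Sum>x0\<in>F. \<bar>l x0\<bar>) + 2 * \<bar>C\<bar> / m"
  have L0: "L \<ge> 0" unfolding L_def using m by (intro add_nonneg_nonneg sum_nonneg) auto
  have "norm (h i x - h i y) \<le> L * dist x y" if xy: "x \<in> K" "y \<in> K" and i: "i \<in> I" for x y i
  proof (cases "dist x y < m")
    case True
    have "x \<in> (\<Union>x0\<in>F. ball x0 (e x0 / 2))" using F(3) xy(1) by (rule subsetD)
    then obtain x0 where x0: "x0 \<in> F" "dist x0 x < e x0 / 2" by auto
    have "dist x0 y < e x0"
      using dist_triangle[of x0 y x] x0 m'[OF x0(1)] True by linarith
    then have "norm (h i x - h i y) \<le> l x0 * dist x y"
      using x0(2) e[of x0] by (intro l[OF _ _ i]) simp_all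
    also have "\<dots> \<le> L * dist x y"
    proof (rule mult_right_mono)
      have "\<bar>l x0\<bar> \<le> (\<Sum>x0\<in>F. \<bar>l x0\<bar>)" using F(2) x0 by (intro member_le_sum) auto
      moreover have "0 \<le> 2 * \<bar>C\<bar> / m" using m by simp
      ultimately show "l x0 \<le> L" unfolding L_def by linarith
    qed simp
    finally show ?thesis .
  next
    case False
    have "norm (h i x - h i y) \<le> 2 * \<bar>C\<bar>"
      using bnd[OF i xy(1)] bnd[OF i xy(2)] norm_triangle_ineq4[of "h i x" "h i y"] by linarith
    also have "\<dots> = 2 * \<bar>C\<bar> / m * m" using m by simp
    also have "\<dots> \<le> L * dist x y"
      using False m L0 sum_nonneg[of F "\<lambda>x0. \<bar>l x0\<bar>"] by (intro mult_mono) (simp_all add: L_def)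
    finally show ?thesis .
  qed
  then show ?thesis using L0 by blast
qed

section \<open>The input gain and the positive part\<close>

text \<open>The last argument will be \<open>exp z\<close>, which only grows along solutions; so the
  gain at an initial value of \<open>z\<close>, with bounds on the input norms, dominates the gain
  at all later times.\<close>

lemma chi_mono:
  assumes "a > 0" "class_Kinf lam" "class_Kinf \<kappa>" "0 \<le> s1" "s1 \<le> s1'" "s2 \<le> s2'" "0 < s3'" "s3' \<le> s3"
  shows "chi a b lam \<kappa> s1 s2 s3 \<le> chi a b lam \<kappa> s1' s2' s3'"
proof -
  have l: "lam s3' \<le> lam s3" and k: "\<kappa> s3' \<le> \<kappa> s3" and k0: "0 \<le> \<kappa> s3'"
    using assms class_Kinf_mono class_Kinf_nonneg by auto
  have "0 \<le> pos_part (s2 - b - lam s3)" "pos_part (s2 - b - lam s3) \<le> pos_part (s2' - b - lam s3')"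
    using l assms by (auto simp: pos_part_def)
  then have "s1\<^sup>2 + (pos_part (s2 - b - lam s3))\<^sup>2 \<le> s1'\<^sup>2 + (pos_part (s2' - b - lam s3'))\<^sup>2"
    using assms by (intro add_mono power_mono) auto
  then show ?thesis
    unfolding chi_def using k k0 assms(1) by (intro frac_le mult_left_mono mult_nonneg_nonneg) auto
qed

lemma chi_nonneg:
  assumes "a > 0" "class_Kinf \<kappa>" "0 < s3"
  shows "0 \<le> chi a b lam \<kappa> s1 s2 s3"
  unfolding chi_def using assms class_Kinf_nonneg[OF assms(2), of s3]
  by (intro divide_nonneg_nonneg mult_nonneg_nonneg) auto

lemma continuous_on_pos_part [continuous_intros]:
  "continuous_on S g \<Longrightarrow> continuous_on S (\<lambda>x. pos_part (g x))"
  unfolding pos_part_def by (intro continuous_intros)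

lemma continuous_on_chi:
  assumes "class_Kinf lam" "class_Kinf \<kappa>" "continuous_on S g1" "continuous_on S g2" "continuous_on S g3"
    and "\<And>x. x \<in> S \<Longrightarrow> 0 < g3 x"
  shows "continuous_on S (\<lambda>x. chi a b lam \<kappa> (g1 x) (g2 x) (g3 x))"
proof -
  have "g3 ` S \<subseteq> {0..}" using assms(6) by force
  then have "continuous_on S (\<lambda>x. lam (g3 x))" "continuous_on S (\<lambda>x. \<kappa> (g3 x))"
    using continuous_on_compose2[OF class_Kinf_continuous[OF assms(1)] assms(5)]
      continuous_on_compose2[OF class_Kinf_continuous[OF assms(2)] assms(5)] by blast+
  moreover have "1 + \<kappa> (g3 x) \<noteq> 0" if "x \<in> S" for x
    using class_Kinf_nonneg[OF assms(2), of "g3 x"] assms(6)[OF that] by auto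
  ultimately show ?thesis unfolding chi_def using assms(3,4) by (intro continuous_intros) auto
qed

text \<open>Squaring removes the kink of the positive part: in all four sign cases the first-order
  remainder is at most the square of \<open>y - w\<close>.\<close>

lemma has_real_derivative_pos_part_power2:
  "((\<lambda>w. (pos_part w)\<^sup>2) has_real_derivative 2 * pos_part w) (at w)"
  unfolding has_field_derivative_def has_derivative_at_alt
proof (intro conjI allI impI)
  show "bounded_linear ((*) (2 * pos_part w))" by (rule bounded_linear_mult_right)
  fix e :: real assume e: "0 < e"
  have "\<bar>(pos_part y)\<^sup>2 - (pos_part w)\<^sup>2 - 2 * pos_part w * (y - w)\<bar> \<le> e * \<bar>y - w\<bar>"
    if "\<bar>y - w\<bar> < e" for y
  proof -
    have "\<bar>(pos_part y)\<^sup>2 - (pos_part w)\<^sup>2 - 2 * pos_part w * (y - w)\<bar> \<le> (y - w)\<^sup>2"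
    proof (cases "w \<ge> 0"; cases "y \<ge> 0")
      assume "w \<ge> 0" "y \<ge> 0"
      then have "(pos_part y)\<^sup>2 - (pos_part w)\<^sup>2 - 2 * pos_part w * (y - w) = (y - w)\<^sup>2"
        by (simp add: pos_part_def power2_eq_square algebra_simps)
      then show ?thesis by simp
    next
      assume wy: "w \<ge> 0" "\<not> y \<ge> 0"
      then have "(pos_part y)\<^sup>2 - (pos_part w)\<^sup>2 - 2 * pos_part w * (y - w) = w\<^sup>2 + 2 * (w * (- y))"
        by (simp add: pos_part_def power2_eq_square algebra_simps)
      moreover have "0 \<le> w * (- y)" using wy by (intro mult_nonneg_nonneg) auto
      moreover have "(y - w)\<^sup>2 = w\<^sup>2 + 2 * (w * (- y)) + y\<^sup>2" by (simp add: power2_eq_square algebra_simps)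
      moreover have "0 \<le> w\<^sup>2" "0 \<le> y\<^sup>2" by simp_all
      ultimately show ?thesis by linarith
    next
      assume wy: "\<not> w \<ge> 0" "y \<ge> 0"
      then have "y\<^sup>2 \<le> (y - w)\<^sup>2" by (intro power_mono) auto
      then show ?thesis using wy by (simp add: pos_part_def)
    qed (simp add: pos_part_def)
    also have "\<dots> = \<bar>y - w\<bar> * \<bar>y - w\<bar>" by (simp add: power2_eq_square)
    also have "\<dots> \<le> e * \<bar>y - w\<bar>" using that by (intro mult_right_mono) auto
    finally show ?thesis .
  qed
  then show "\<exists>d>0. \<forall>y. norm (y - w) < d \<longrightarrow>
      norm ((pos_part y)\<^sup>2 - (pos_part w)\<^sup>2 - 2 * pos_part w * (y - w)) \<le> e * norm (y - w)"
    using e by (intro exI[of _ e]) auto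
qed

lemma mono_bounded_tendsto_Sup:
  fixes g :: "real \<Rightarrow> real"
  assumes mono: "\<And>s t. 0 \<le> s \<Longrightarrow> s \<le> t \<Longrightarrow> g s \<le> g t" and bnd: "\<And>t. t \<ge> 0 \<Longrightarrow> g t \<le> Z"
  shows "\<exists>l\<le>Z. (g \<longlongrightarrow> l) at_top \<and> (\<forall>t\<ge>0. g t \<le> l)"
proof -
  let ?l = "Sup (g ` {0..})"
  have bdd: "bdd_above (g ` {0..})" using bnd by (intro bdd_aboveI2) auto
  have le: "g t \<le> ?l" if "t \<ge> 0" for t using bdd that by (intro cSup_upper) auto
  have "(g \<longlongrightarrow> ?l) at_top"
  proof (rule increasing_tendsto)
    show "\<forall>\<^sub>F t in at_top. g t \<le> ?l" using eventually_ge_at_top[of 0] by eventually_elim (rule le)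
    fix y assume "y < ?l"
    then have "\<exists>v\<in>g ` {0..}. y < v" by (subst (asm) less_cSup_iff[OF _ bdd]) auto
    then obtain s where s: "s \<ge> 0" "y < g s" by auto
    show "\<forall>\<^sub>F t in at_top. y < g t"
      using eventually_ge_at_top[of s] by eventually_elim (rule less_le_trans[OF s(2) mono[OF s(1)]])
  qed
  moreover have "?l \<le> Z" using bnd by (intro cSup_least) auto
  ultimately show ?thesis using le by blast
qed

text \<open>Changing inputs on a null set leaves the integral equation intact, so inputs bounded
  almost everywhere may be replaced by inputs bounded at every time.\<close>

lemma sol_on_spike:
  assumes N: "negligible {t \<in> {0..}. \<theta> t \<noteq> \<theta>' t \<or> d t \<noteq> d' t}"
  shows "sol_on f V \<Gamma> \<epsilon> \<theta> d x0 T x \<longleftrightarrow> sol_on f V \<Gamma> \<epsilon> \<theta>' d' x0 T x"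
proof -
  let ?g = "\<lambda>s. rhs f V \<Gamma> \<epsilon> (\<theta> s) (d s) (x s)" and ?g' = "\<lambda>s. rhs f V \<Gamma> \<epsilon> (\<theta>' s) (d' s) (x s)"
  have eq: "s \<in> {0..t} - {t \<in> {0..}. \<theta> t \<noteq> \<theta>' t \<or> d t \<noteq> d' t} \<Longrightarrow> ?g s = ?g' s" for s t by auto
  have "?g integrable_on {0..t} \<longleftrightarrow> ?g' integrable_on {0..t}" for t
    by (rule iffI; erule integrable_spike[OF _ N]) (use eq in auto)
  moreover have "integral {0..t} ?g = integral {0..t} ?g'" for t
    by (rule integral_spike[OF N]) (use eq in auto)
  ultimately show ?thesis by (simp add: sol_on_def)
qed

lemma borel_measurable_lebesgue_onI:
  fixes g :: "'c::euclidean_space \<Rightarrow> 'd::euclidean_space"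
  assumes "g \<in> borel_measurable (restrict_space lborel S)" "S \<in> sets borel"
  shows "g \<in> borel_measurable (lebesgue_on S)"
  using assms by (simp add: borel_measurable_restrict_space_iff measurable_completion)

section \<open>The adaptive system\<close>

locale adaptive_system =
  fixes f :: "'a::euclidean_space \<Rightarrow> real \<Rightarrow> 'p::euclidean_space \<Rightarrow> 'l::euclidean_space \<Rightarrow> 'a"
    and V :: "'a \<Rightarrow> real \<Rightarrow> real"
    and V\<xi> :: "'a \<Rightarrow> real \<Rightarrow> 'a" and Vz :: "'a \<Rightarrow> real \<Rightarrow> real"
    and \<Theta> :: "'p set" and D :: "'l set"
    and \<Gamma> \<epsilon> a b :: real
    and \<kappa> lam \<rho> :: "real \<Rightarrow> real"
  assumes \<Theta>: "closed \<Theta>" "0 \<in> \<Theta>"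
    and D: "closed D" "0 \<in> D"
    and \<Gamma>: "\<Gamma> > 0" and \<epsilon>: "\<epsilon> > 0"
    and f_cont: "continuous_on (UNIV \<times> UNIV \<times> \<Theta> \<times> D) (\<lambda>(\<xi>, z, th, dd). f \<xi> z th dd)"
    and f_lip: "\<And>x0 R. \<exists>e>0. \<exists>L. \<forall>x1\<in>ball x0 e. \<forall>x2\<in>ball x0 e. \<forall>th\<in>\<Theta>. \<forall>dd\<in>D.
                   norm th \<le> R \<longrightarrow> norm dd \<le> R \<longrightarrow>
                   norm (f (fst x1) (snd x1) th dd - f (fst x2) (snd x2) th dd) \<le> L * dist x1 x2"
    and V_deriv: "\<And>\<xi> z. ((\<lambda>(x, y). V x y) has_derivative (\<lambda>(h, k). V\<xi> \<xi> z \<bullet> h + Vz \<xi> z * k)) (at (\<xi>, z))"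
    and V\<xi>_cont: "continuous_on UNIV (\<lambda>(x, y). V\<xi> x y)"
    and Vz_cont: "continuous_on UNIV (\<lambda>(x, y). Vz x y)"
    and V_zero: "\<And>z. V 0 z = 0"
    and V_pos: "\<And>\<xi> z. \<xi> \<noteq> 0 \<Longrightarrow> V \<xi> z > 0"
    and bnd: "\<And>M. M > 0 \<Longrightarrow> bounded {(\<xi>, z). z \<in> {-M..M} \<and> V \<xi> z \<le> M}"
    and K: "class_Kinf \<kappa>" "class_Kinf lam" "class_Kinf \<rho>"
    and a: "a > 0" and b: "b \<ge> 0"
    and dissip: "\<And>\<xi> z th dd. th \<in> \<Theta> \<Longrightarrow> dd \<in> D \<Longrightarrow>
        V\<xi> \<xi> z \<bullet> f \<xi> z th dd + \<Gamma> * exp (- z) * Vz \<xi> z * pos_part (V \<xi> z - \<epsilon>)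
          \<le> - \<rho> (V \<xi> z) + chi a b lam \<kappa> (norm dd) (norm th) (exp z)"
begin

abbreviation F :: "'p \<Rightarrow> 'l \<Rightarrow> 'a \<times> real \<Rightarrow> 'a \<times> real" where
  "F \<equiv> rhs f V \<Gamma> \<epsilon>"

abbreviation U :: "'a \<times> real \<Rightarrow> real" where
  "U x \<equiv> V (fst x) (snd x)"

text \<open>The joint gradient of \<open>V\<close> as one vector of the product space, the form in
  which the chain rule for primitives takes it.\<close>

definition DU :: "'a \<times> real \<Rightarrow> 'a \<times> real" where
  "DU x = (V\<xi> (fst x) (snd x), Vz (fst x) (snd x))"

abbreviation gain :: "real \<Rightarrow> real \<Rightarrow> real \<Rightarrow> real" where
  "gain \<equiv> chi a b lam \<kappa>"

section \<open>Regularity of \<open>V\<close> and of the vector field\<close>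

lemma U_deriv: "(U has_derivative (\<lambda>h. DU y \<bullet> h)) (at y)"
  using V_deriv[of "fst y" "snd y"] by (simp add: DU_def case_prod_unfold inner_prod_def)

lemma DU_cont: "continuous_on UNIV DU"
  using V\<xi>_cont Vz_cont unfolding DU_def case_prod_unfold by (intro continuous_intros) auto

lemma U_cont: "continuous_on S U"
  by (intro continuous_at_imp_continuous_on ballI has_derivative_continuous[OF U_deriv])

lemma U_nonneg: "0 \<le> U x"
  using V_zero[of "snd x"] V_pos[of "fst x" "snd x"] by (cases "fst x = 0") auto

lemma rhs_cont: "continuous_on (UNIV \<times> \<Theta> \<times> D) (\<lambda>(x, th, dd). F th dd x)"
proof -
  have "continuous_on (UNIV \<times> \<Theta> \<times> D) (\<lambda>p. (\<lambda>(\<xi>, z, th, dd). f \<xi> z th dd)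
      (fst (fst p), snd (fst p), fst (snd p), snd (snd p)))"
    by (rule continuous_on_compose2[OF f_cont]) (auto intro!: continuous_intros)
  then have "continuous_on (UNIV \<times> \<Theta> \<times> D) (\<lambda>p. f (fst (fst p)) (snd (fst p)) (fst (snd p)) (snd (snd p)))"
    by (simp only: prod.case)
  moreover have "continuous_on (UNIV \<times> \<Theta> \<times> D) (\<lambda>p. U (fst p))"
    by (rule continuous_on_compose2[OF U_cont[of UNIV]]) (auto intro!: continuous_intros)
  ultimately show ?thesis
    unfolding rhs_def case_prod_unfold by (intro continuous_intros) auto
qed

text \<open>Closedness of \<open>\<Theta>\<close> and \<open>D\<close> makes the bounded part of the
  domain compact, and the vector field is continuous on it.\<close>

lemma rhs_bounded:
  "\<exists>C. \<forall>x th dd. norm x \<le> r \<longrightarrow> th \<in> \<Theta> \<longrightarrow> dd \<in> D \<longrightarrow> norm th \<le> R \<longrightarrow> norm dd \<le> R \<longrightarrow> norm (F th dd x) \<le> C"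
proof -
  let ?S = "cball (0 :: 'a \<times> real) r \<times> (\<Theta> \<inter> cball 0 R) \<times> (D \<inter> cball 0 R)"
  have "compact ?S" using \<Theta> D by (intro compact_Times closed_Int_compact compact_cball)
  then have "compact ((\<lambda>(x, th, dd). F th dd x) ` ?S)"
    by (intro compact_continuous_image continuous_on_subset[OF rhs_cont]) auto
  then have "bounded ((\<lambda>(x, th, dd). F th dd x) ` ?S)" by (rule compact_imp_bounded)
  then obtain C where C: "\<forall>y\<in>(\<lambda>(x, th, dd). F th dd x) ` ?S. norm y \<le> C"
    unfolding bounded_iff by (rule exE)
  show ?thesis
  proof (intro exI[of _ C] allI impI)
    fix x :: "'a \<times> real" and th dd assume "norm x \<le> r" "th \<in> \<Theta>" "dd \<in> D" "norm th \<le> R" "norm dd \<le> R"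
    then have "(x, th, dd) \<in> ?S" by simp
    from imageI[OF this, of "\<lambda>(x, th, dd). F th dd x"] show "norm (F th dd x) \<le> C"
      using C by (simp only: prod.case)
  qed
qed

lemma rhs_lipschitz:
  "\<exists>L>0. \<forall>x y th dd. norm x \<le> r \<longrightarrow> norm y \<le> r \<longrightarrow> th \<in> \<Theta> \<longrightarrow> dd \<in> D \<longrightarrow>
    norm th \<le> R \<longrightarrow> norm dd \<le> R \<longrightarrow> norm (F th dd x - F th dd y) \<le> L * norm (x - y)"
proof -
  let ?I = "{(th, dd). th \<in> \<Theta> \<and> dd \<in> D \<and> norm th \<le> R \<and> norm dd \<le> R}"
  let ?h = "\<lambda>i x. f (fst x) (snd x) (fst i) (snd i)"
  obtain C where C: "\<And>x th dd. norm x \<le> r \<Longrightarrow> th \<in> \<Theta> \<Longrightarrow> dd \<in> D \<Longrightarrow> norm th \<le> R \<Longrightarrow> norm dd \<le> R \<Longrightarrow> norm (F th dd x) \<le> C"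
    using rhs_bounded[of r R] by blast
  have "\<exists>L\<ge>0. \<forall>x\<in>cball 0 r. \<forall>y\<in>cball 0 r. \<forall>i\<in>?I. norm (?h i x - ?h i y) \<le> L * dist x y"
  proof (rule lipschitz_on_compact_of_local)
    show "compact (cball (0::'a \<times> real) r)" by simp
    show "\<exists>e>0. \<exists>L. \<forall>x1\<in>ball x0 e. \<forall>x2\<in>ball x0 e. \<forall>i\<in>?I. norm (?h i x1 - ?h i x2) \<le> L * dist x1 x2" for x0
      using f_lip[of x0 R] by fastforce
    fix i and x :: "'a \<times> real" assume i: "i \<in> ?I" and x: "x \<in> cball 0 r"
    have "norm (fst (F (fst i) (snd i) x)) \<le> norm (F (fst i) (snd i) x)" by (metis norm_fst_le prod.collapse)
    also have "\<dots> \<le> C" using i x by (intro C) auto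
    finally show "norm (?h i x) \<le> C" by (simp add: rhs_def)
  qed
  then obtain L1 where L1: "L1 \<ge> 0"
    "\<And>x y i. x \<in> cball 0 r \<Longrightarrow> y \<in> cball 0 r \<Longrightarrow> i \<in> ?I \<Longrightarrow> norm (?h i x - ?h i y) \<le> L1 * dist x y"
    by blast
  \<comment> \<open>With the positive factor \<open>\<Gamma> * exp (- z)\<close> moved inside the
    positive part, the second component is a C1 function followed by a map with Lipschitz constant
    1.\<close>
  define G where "G x = \<Gamma> * exp (- snd x) * (U x - \<epsilon>)" for x :: "'a \<times> real"
  define DG where "DG x = (\<Gamma> * exp (- snd x)) *\<^sub>R DU x - (0, \<Gamma> * exp (- snd x) * (U x - \<epsilon>))" for x
  have "(G has_derivative (\<lambda>h. DG y \<bullet> h)) (at y)" for y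
    unfolding G_def DG_def
    by (auto intro!: derivative_eq_intros U_deriv simp: inner_diff_left inner_prod_def algebra_simps)
  moreover have "continuous_on UNIV DG"
    unfolding DG_def by (intro continuous_intros DU_cont U_cont)
  ultimately obtain L2 where L2: "L2 \<ge> 0"
    "\<And>x y. x \<in> cball 0 r \<Longrightarrow> y \<in> cball 0 r \<Longrightarrow> \<bar>G x - G y\<bar> \<le> L2 * norm (x - y)"
    using lipschitz_on_cball_of_C1[of G DG r] by blast
  have snd_rhs: "\<Gamma> * exp (- snd x) * pos_part (U x - \<epsilon>) = pos_part (G x)" for x
    using \<Gamma> by (auto simp: pos_part_def G_def max_def zero_le_mult_iff mult_le_0_iff)
  \<comment> \<open>The summand 1 makes the constant strictly positive, as the Picard lemma
    asks.\<close>
  have "norm (F th dd x - F th dd y) \<le> (L1 + L2 + 1) * norm (x - y)"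
    if xy: "norm x \<le> r" "norm y \<le> r" and i: "th \<in> \<Theta>" "dd \<in> D" "norm th \<le> R" "norm dd \<le> R" for x y th dd
  proof -
    have "norm (F th dd x - F th dd y) \<le>
        norm (f (fst x) (snd x) th dd - f (fst y) (snd y) th dd) + \<bar>pos_part (G x) - pos_part (G y)\<bar>"
      using norm_Pair_le[of "f (fst x) (snd x) th dd - f (fst y) (snd y) th dd" "pos_part (G x) - pos_part (G y)"]
      by (simp add: rhs_def snd_rhs)
    also have "\<dots> \<le> L1 * norm (x - y) + L2 * norm (x - y)"
    proof (rule add_mono)
      show "norm (f (fst x) (snd x) th dd - f (fst y) (snd y) th dd) \<le> L1 * norm (x - y)"
        using L1(2)[of x y "(th, dd)"] xy i by (simp add: dist_norm)
      have "\<bar>pos_part (G x) - pos_part (G y)\<bar> \<le> \<bar>G x - G y\<bar>" by (auto simp: pos_part_def)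
      also have "\<dots> \<le> L2 * norm (x - y)" using L2(2) xy by simp
      finally show "\<bar>pos_part (G x) - pos_part (G y)\<bar> \<le> L2 * norm (x - y)" .
    qed
    also have "\<dots> \<le> (L1 + L2 + 1) * norm (x - y)" by (simp add: algebra_simps)
    finally show ?thesis .
  qed
  then show ?thesis using L1(1) L2(1) by (intro exI[of _ "L1 + L2 + 1"]) auto
qed

text \<open>Here the norm bounds hold at every time. Essentially bounded inputs are brought to this
  form by a change on a null set; \<open>n1\<close> bounds \<open>d\<close> and \<open>n2\<close>
  bounds \<open>\<theta>\<close>, in the argument order of the gain.\<close>

definition admissible :: "real \<Rightarrow> real \<Rightarrow> (real \<Rightarrow> 'p) \<Rightarrow> (real \<Rightarrow> 'l) \<Rightarrow> bool" where
  "admissible n1 n2 \<theta> d \<longleftrightarrow> \<theta> \<in> borel_measurable (restrict_space lborel {0..}) \<and>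
     d \<in> borel_measurable (restrict_space lborel {0..}) \<and>
     (\<forall>t\<ge>0. \<theta> t \<in> \<Theta> \<and> d t \<in> D \<and> norm (d t) \<le> n1 \<and> norm (\<theta> t) \<le> n2)"

lemma admissibleD:
  assumes "admissible n1 n2 \<theta> d" "t \<ge> 0"
  shows "\<theta> t \<in> \<Theta>" "d t \<in> D" "norm (d t) \<le> n1" "norm (\<theta> t) \<le> n2"
    "norm (d t) \<le> max n1 n2" "norm (\<theta> t) \<le> max n1 n2" "0 \<le> n1" "0 \<le> n2"
  using assms order_trans[OF norm_ge_zero, of "d t" n1] order_trans[OF norm_ge_zero, of "\<theta> t" n2]
  by (auto simp: admissible_def le_max_iff_disj)

text \<open>Measurability comes from composing the measurable triple of state and inputs with a map
  that is continuous on the set where the triple takes its values; compactness of the trajectory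
  gives the bound.\<close>

lemma rhs_integrable:
  assumes adm: "admissible n1 n2 \<theta> d" and x: "continuous_on {0..T} x"
  shows "(\<lambda>s. F (\<theta> s) (d s) (x s)) integrable_on {0..T}" "bounded ((\<lambda>s. F (\<theta> s) (d s) (x s)) ` {0..T})"
proof -
  let ?M = "restrict_space lborel {0..T}" and ?S = "(UNIV :: ('a \<times> real) set) \<times> \<Theta> \<times> D"
  have "compact (x ` {0..T})" using x by (intro compact_continuous_image) auto
  then obtain r where r: "\<And>s. s \<in> {0..T} \<Longrightarrow> norm (x s) \<le> r"
    using compact_imp_bounded[of "x ` {0..T}"] unfolding bounded_iff by blast
  obtain C where C: "\<And>x th dd. norm x \<le> r \<Longrightarrow> th \<in> \<Theta> \<Longrightarrow> dd \<in> D \<Longrightarrow> norm th \<le> max n1 n2 \<Longrightarrow> norm dd \<le> max n1 n2 \<Longrightarrow> norm (F th dd x) \<le> C"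
    using rhs_bounded[of r "max n1 n2"] by blast
  have le: "norm (F (\<theta> s) (d s) (x s)) \<le> C" if "s \<in> {0..T}" for s
    using that r admissibleD[OF adm, of s] by (intro C) auto
  then show "bounded ((\<lambda>s. F (\<theta> s) (d s) (x s)) ` {0..T})" by (intro boundedI) blast
  have xm: "x \<in> borel_measurable ?M"
    using borel_measurable_continuous_on_restrict[OF x]
    by (subst measurable_cong_sets[OF sets_restrict_space_cong[OF sets_lborel] refl])
  have "\<theta> \<in> borel_measurable ?M" "d \<in> borel_measurable ?M"
    using adm by (auto simp: admissible_def intro: measurable_restrict_mono)
  then have "(\<lambda>s. (x s, \<theta> s, d s)) \<in> ?M \<rightarrow>\<^sub>M borel"
    using xm by (intro borel_measurable_Pair)
  then have "(\<lambda>s. (x s, \<theta> s, d s)) \<in> ?M \<rightarrow>\<^sub>M restrict_space borel ?S"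
    using adm by (intro measurable_restrict_space2) (auto simp: admissible_def)
  from measurable_compose[OF this borel_measurable_continuous_on_restrict[OF rhs_cont]]
  have "(\<lambda>s. F (\<theta> s) (d s) (x s)) \<in> borel_measurable (lebesgue_on {0..T})"
    by (intro borel_measurable_lebesgue_onI) auto
  then show "(\<lambda>s. F (\<theta> s) (d s) (x s)) integrable_on {0..T}"
    by (rule measurable_bounded_by_integrable_imp_integrable[where g = "\<lambda>_. C"]) (use le in auto)
qed

section \<open>Differential inequalities along trajectories\<close>

lemma U_decay:
  assumes "th \<in> \<Theta>" "dd \<in> D"
  shows "DU x \<bullet> F th dd x \<le> - \<rho> (U x) + gain (norm dd) (norm th) (exp (snd x))"
  using dissip[OF assms, of "fst x" "snd x"] by (simp add: DU_def rhs_def inner_prod_def algebra_simps)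

lemma gain_nonneg: "0 \<le> gain s1 s2 (exp z)"
  using a K by (intro chi_nonneg) auto

lemma rho_nonneg: "0 \<le> \<rho> (U x)"
  using class_Kinf_nonneg[OF K(3) U_nonneg] .

lemma primitive_on_U:
  "primitive_on p q x g \<Longrightarrow> primitive_on p q (\<lambda>s. U (x s)) (\<lambda>s. DU (x s) \<bullet> g s)"
  by (rule primitive_on_compose[OF _ U_deriv DU_cont])

lemma z_mono:
  assumes x: "primitive_on p q x (\<lambda>s. F (\<theta> s) (d s) (x s))" and pq: "p \<le> q"
  shows "snd (x p) \<le> snd (x q)"
proof -
  have "primitive_on p q (\<lambda>s. - snd (x s)) (\<lambda>s. (0, - 1) \<bullet> F (\<theta> s) (d s) (x s))"
    by (rule primitive_on_compose[OF x]) (auto intro!: derivative_eq_intros simp: inner_prod_def)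
  then have "- snd (x q) \<le> - snd (x p) + 0 * (q - p)"
    by (rule primitive_on_mono[OF _ pq negligible_empty]) (use \<Gamma> in \<open>auto simp: rhs_def inner_prod_def pos_part_def\<close>)
  then show ?thesis by simp
qed

text \<open>The factor \<open>exp (- z)\<close> of the adaptation law cancels in the derivative of
  \<open>exp z\<close>, leaving \<open>\<Gamma>\<close> times the excess of \<open>U\<close> over
  \<open>\<epsilon>\<close>. The sign is reversed in the proof so that the upper estimate for
  primitives applies.\<close>

lemma exp_z_growth:
  assumes x: "primitive_on p q x (\<lambda>s. F (\<theta> s) (d s) (x s))" and pq: "p \<le> q"
    and ge: "\<And>s. s \<in> {p..q} \<Longrightarrow> m \<le> U (x s) - \<epsilon>"
  shows "\<Gamma> * m * (q - p) \<le> exp (snd (x q)) - exp (snd (x p))"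
proof -
  have "primitive_on p q (\<lambda>s. - exp (snd (x s))) (\<lambda>s. (0, - exp (snd (x s))) \<bullet> F (\<theta> s) (d s) (x s))"
    by (rule primitive_on_compose[OF x]) (auto intro!: derivative_eq_intros continuous_intros simp: inner_prod_def)
  then have "- exp (snd (x q)) \<le> - exp (snd (x p)) + (- (\<Gamma> * m)) * (q - p)"
  proof (rule primitive_on_mono[OF _ pq negligible_empty])
    fix s assume "s \<in> {p..q} - {}"
    then have "m \<le> pos_part (U (x s) - \<epsilon>)" using ge[of s] by (simp add: pos_part_def)
    then have "\<Gamma> * m \<le> \<Gamma> * pos_part (U (x s) - \<epsilon>)" using \<Gamma> by simp
    moreover have "(0, - exp (snd (x s))) \<bullet> F (\<theta> s) (d s) (x s) = - (\<Gamma> * pos_part (U (x s) - \<epsilon>))"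
      by (simp add: rhs_def inner_prod_def exp_minus)
    ultimately show "(0, - exp (snd (x s))) \<bullet> F (\<theta> s) (d s) (x s) \<le> - (\<Gamma> * m)" by simp
  qed
  then show ?thesis by simp
qed

text \<open>The bounds \<open>m1\<close>, \<open>m2\<close> are asked only on the interval and off a
  null set, so the estimate can be restarted at a late time with sharper bounds. Monotonicity of
  \<open>z\<close> lets its value at \<open>p\<close> control the gain throughout.\<close>

lemma U_comparison:
  assumes cmp: "comparison_pair \<rho> \<sigma> \<gamma>" and adm: "admissible n1 n2 \<theta> d"
    and x: "primitive_on p q x (\<lambda>s. F (\<theta> s) (d s) (x s))" and pq: "0 \<le> p" "p \<le> q"
    and N: "negligible N" and le: "\<And>s. s \<in> {p..q} - N \<Longrightarrow> norm (d s) \<le> m1 \<and> norm (\<theta> s) \<le> m2"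
    and z: "z \<le> snd (x p)"
  shows "U (x q) \<le> \<sigma> (U (x p)) (q - p) + \<gamma> (gain m1 m2 (exp z))"
proof (rule comparison_pairD[OF cmp primitive_on_U[OF x] pq(2) U_nonneg N gain_nonneg])
  fix s assume s: "s \<in> {p..q} - N"
  have "snd (x p) \<le> snd (x s)" using s by (intro z_mono[OF primitive_on_subinterval[OF x]]) auto
  then have "gain (norm (d s)) (norm (\<theta> s)) (exp (snd (x s))) \<le> gain m1 m2 (exp z)"
    using le[OF s] z a K by (intro chi_mono) auto
  moreover have "DU (x s) \<bullet> F (\<theta> s) (d s) (x s) \<le>
      - \<rho> (U (x s)) + gain (norm (d s)) (norm (\<theta> s)) (exp (snd (x s)))"
    using s pq admissibleD[OF adm, of s] by (intro U_decay) auto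
  ultimately show "DU (x s) \<bullet> F (\<theta> s) (d s) (x s) \<le> - \<rho> (U (x s)) + gain m1 m2 (exp z)" by simp
qed

text \<open>Once \<open>exp z\<close> exceeds \<open>Y\<close>, the sum of \<open>exp z\<close> and a multiple of the squared excess of \<open>V\<close>
  over \<open>\<epsilon>\<close> no longer increases.\<close>

lemma exp_z_bound:
  assumes adm: "admissible n1 n2 \<theta> d" and T: "0 \<le> T"
    and x: "primitive_on 0 T x (\<lambda>s. F (\<theta> s) (d s) (x s))"
    and M: "\<And>s. s \<in> {0..T} \<Longrightarrow> U (x s) \<le> M" and M0: "0 \<le> M"
    and Y: "exp (snd (x 0)) \<le> Y" "\<And>y. Y \<le> y \<Longrightarrow> gain n1 n2 y \<le> \<rho> \<epsilon> / 2"
  shows "exp (snd (x T)) \<le> Y + \<Gamma> * M\<^sup>2 / \<rho> \<epsilon>"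
proof -
  have \<rho>\<epsilon>: "\<rho> \<epsilon> > 0" using class_Kinf_pos[OF K(3) \<epsilon>] .
  show ?thesis
  proof (cases "exp (snd (x T)) \<le> Y")
    case True
    moreover have "0 \<le> \<Gamma> * M\<^sup>2 / \<rho> \<epsilon>" using \<Gamma> \<rho>\<epsilon> by simp
    ultimately show ?thesis by linarith
  next
    case False
    have "continuous_on {0..T} (\<lambda>s. exp (snd (x s)))"
      by (intro continuous_intros primitive_on_continuous[OF x])
    from last_time_below[OF this, of 0 Y] obtain r where r: "0 \<le> r" "r < T" "exp (snd (x r)) \<le> Y"
      and above: "\<And>t. t \<in> {r<..T} \<Longrightarrow> Y < exp (snd (x t))"
      using False T Y(1) by auto
    \<comment> \<open>While \<open>U\<close> exceeds \<open>\<epsilon>\<close> it falls at rate at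
      least \<open>\<rho> \<epsilon> / 2\<close>. The coefficient
      \<open>\<Gamma> / \<rho> \<epsilon>\<close> makes the squared excess \<open>P\<close>
      contribute at most \<open>- \<Gamma> * P\<close>, which cancels the growth of
      \<open>exp z\<close>.\<close>
    define G where "G y = \<Gamma> / \<rho> \<epsilon> * (pos_part (U y - \<epsilon>))\<^sup>2 + exp (snd y)" for y :: "'a \<times> real"
    define DG where "DG y = (\<Gamma> / \<rho> \<epsilon> * (2 * pos_part (U y - \<epsilon>))) *\<^sub>R DU y + (0, exp (snd y))" for y
    have "((\<lambda>y. (pos_part (U y - \<epsilon>))\<^sup>2) has_derivative (\<lambda>h. DU y \<bullet> h * (2 * pos_part (U y - \<epsilon>)))) (at y)" for y
      by (rule DERIV_compose_FDERIV[OF has_real_derivative_pos_part_power2])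
        (auto intro!: derivative_eq_intros U_deriv)
    then have "(G has_derivative (\<lambda>h. \<Gamma> / \<rho> \<epsilon> * (DU y \<bullet> h * (2 * pos_part (U y - \<epsilon>))) + exp (snd y) * snd h)) (at y)" for y
      unfolding G_def by (intro has_derivative_add has_derivative_mult_right) (auto intro!: derivative_eq_intros)
    then have G': "(G has_derivative (\<lambda>h. DG y \<bullet> h)) (at y)" for y
      by (rule has_derivative_eq_rhs) (simp add: fun_eq_iff DG_def inner_add_left inner_prod_def algebra_simps)
    have DGc: "continuous_on UNIV DG"
      unfolding DG_def by (intro continuous_intros DU_cont U_cont)
    have "primitive_on r T x (\<lambda>s. F (\<theta> s) (d s) (x s))"
      using r by (intro primitive_on_subinterval[OF x]) auto
    note G_prim = primitive_on_compose[OF this G' DGc]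
    have "G (x T) \<le> G (x r) + 0 * (T - r)"
    proof (rule primitive_on_mono[OF G_prim])
      \<comment> \<open>At \<open>r\<close> itself \<open>exp z\<close> is at most \<open>Y\<close>,
        so the smallness of the gain is used only at later times.\<close>
      show "r \<le> T" "negligible {r}" using r by auto
      fix s assume s: "s \<in> {r..T} - {r}"
      define P where "P = pos_part (U (x s) - \<epsilon>)"
      have s0: "0 \<le> s" using s r by auto
      have "gain (norm (d s)) (norm (\<theta> s)) (exp (snd (x s))) \<le> gain n1 n2 (exp (snd (x s)))"
        using admissibleD[OF adm s0] a K by (intro chi_mono) auto
      also have "\<dots> \<le> \<rho> \<epsilon> / 2" using above[of s] s by (intro Y(2)) auto
      finally have w: "DU (x s) \<bullet> F (\<theta> s) (d s) (x s) \<le> - \<rho> (U (x s)) + \<rho> \<epsilon> / 2"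
        using U_decay[of "\<theta> s" "d s" "x s"] admissibleD[OF adm s0] by auto
      have "P * (DU (x s) \<bullet> F (\<theta> s) (d s) (x s)) \<le> P * (- (\<rho> \<epsilon> / 2))"
      proof (cases "U (x s) \<le> \<epsilon>")
        case False
        then have "\<rho> \<epsilon> \<le> \<rho> (U (x s))" using \<epsilon> by (intro class_Kinf_mono[OF K(3)]) auto
        then show ?thesis using w by (intro mult_left_mono) (auto simp: P_def pos_part_def)
      qed (simp add: P_def pos_part_def)
      then have "\<Gamma> / \<rho> \<epsilon> * 2 * (P * (DU (x s) \<bullet> F (\<theta> s) (d s) (x s))) \<le> \<Gamma> / \<rho> \<epsilon> * 2 * (P * (- (\<rho> \<epsilon> / 2)))"
        by (rule mult_left_mono) (use \<Gamma> \<rho>\<epsilon> in auto)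
      also have "\<dots> = - (\<Gamma> * P)" using \<rho>\<epsilon> by simp
      finally have "\<Gamma> / \<rho> \<epsilon> * 2 * (P * (DU (x s) \<bullet> F (\<theta> s) (d s) (x s))) + \<Gamma> * P \<le> 0" by simp
      moreover have "DG (x s) \<bullet> F (\<theta> s) (d s) (x s) =
          \<Gamma> / \<rho> \<epsilon> * 2 * (P * (DU (x s) \<bullet> F (\<theta> s) (d s) (x s))) + \<Gamma> * P"
      proof -
        have "(0, exp (snd (x s))) \<bullet> F (\<theta> s) (d s) (x s) = \<Gamma> * P"
          by (simp add: rhs_def inner_prod_def P_def exp_minus)
        then show ?thesis by (simp add: DG_def inner_add_left P_def)
      qed
      ultimately show "DG (x s) \<bullet> F (\<theta> s) (d s) (x s) \<le> 0" by simp
    qed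
    moreover have "exp (snd (x T)) \<le> G (x T)" using \<Gamma> \<rho>\<epsilon> by (simp add: G_def)
    moreover have "G (x r) \<le> \<Gamma> * M\<^sup>2 / \<rho> \<epsilon> + Y"
    proof -
      have "pos_part (U (x r) - \<epsilon>) \<le> M" "0 \<le> pos_part (U (x r) - \<epsilon>)"
        using M[of r] r M0 \<epsilon> by (auto simp: pos_part_def)
      then have "(pos_part (U (x r) - \<epsilon>))\<^sup>2 \<le> M\<^sup>2" by (intro power_mono)
      then have "\<Gamma> / \<rho> \<epsilon> * (pos_part (U (x r) - \<epsilon>))\<^sup>2 \<le> \<Gamma> / \<rho> \<epsilon> * M\<^sup>2"
        using \<Gamma> \<rho>\<epsilon> by (intro mult_left_mono) auto
      then show ?thesis using r(3) by (simp add: G_def)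
    qed
    ultimately show ?thesis by simp
  qed
qed

text \<open>The numerator of the gain is at most \<open>a * (n1\<^sup>2 + n2\<^sup>2)\<close>
  because \<open>b\<close> and \<open>lam y\<close> only reduce it; the threshold on
  \<open>y\<close> makes \<open>\<kappa> y\<close> large enough to compensate.\<close>

lemma gain_small:
  assumes \<kappa>i: "\<And>s. s \<ge> 0 \<Longrightarrow> \<kappa>i s \<ge> 0" "\<And>s. s \<ge> 0 \<Longrightarrow> \<kappa> (\<kappa>i s) = s"
    and n: "0 \<le> n1" "0 \<le> n2" and y: "0 < y" "\<kappa>i (2 * a * (n1\<^sup>2 + n2\<^sup>2) / \<rho> \<epsilon>) \<le> y"
  shows "gain n1 n2 y \<le> \<rho> \<epsilon> / 2"
proof -
  have \<rho>\<epsilon>: "\<rho> \<epsilon> > 0" using class_Kinf_pos[OF K(3) \<epsilon>] .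
  let ?q = "2 * a * (n1\<^sup>2 + n2\<^sup>2) / \<rho> \<epsilon>"
  have q: "?q \<ge> 0" using a \<rho>\<epsilon> by simp
  have "?q \<le> \<kappa> y" using class_Kinf_mono[OF K(1) \<kappa>i(1)[OF q] y(2)] \<kappa>i(2)[OF q] by simp
  then have le: "a * (n1\<^sup>2 + n2\<^sup>2) \<le> \<rho> \<epsilon> / 2 * \<kappa> y" using \<rho>\<epsilon> by (simp add: field_simps)
  have ky: "0 \<le> \<kappa> y" using class_Kinf_nonneg[OF K(1)] y by auto
  have "pos_part (n2 - b - lam y) \<le> n2" "0 \<le> pos_part (n2 - b - lam y)"
    using class_Kinf_nonneg[OF K(2), of y] y b n by (auto simp: pos_part_def)
  then have "(pos_part (n2 - b - lam y))\<^sup>2 \<le> n2\<^sup>2" by (intro power_mono)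
  then have "a * (n1\<^sup>2 + (pos_part (n2 - b - lam y))\<^sup>2) \<le> a * (n1\<^sup>2 + n2\<^sup>2)" using a by simp
  also have "\<dots> \<le> \<rho> \<epsilon> / 2 * (1 + \<kappa> y)" using le \<rho>\<epsilon> by (simp add: algebra_simps)
  finally show ?thesis unfolding chi_def using ky by (simp add: pos_divide_le_eq)
qed

text \<open>The largest norm of \<open>\<xi>\<close> over the sublevel set is finite and monotone in
  the level, but may jump. A continuous majorant replaces it, since the final bound has to be
  continuous.\<close>

lemma sublevel_radius:
  obtains R where "continuous_on UNIV R" "\<And>m. 0 \<le> R m"
    "\<And>m \<xi> z. 0 < m \<Longrightarrow> \<bar>z\<bar> \<le> m \<Longrightarrow> V \<xi> z \<le> m \<Longrightarrow> norm \<xi> \<le> R m"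
proof -
  define S where "S m = {(\<xi>, z). z \<in> {-m..m} \<and> V \<xi> z \<le> m}" for m
  \<comment> \<open>The value 0 at nonpositive levels, where boundedness of the sublevel set is not
    assumed, keeps \<open>r\<close> monotone on the whole line.\<close>
  define r where "r m = (if m \<le> 0 then 0 else Sup ((\<lambda>p. norm (fst p)) ` S m))" for m
  have bdd: "bdd_above ((\<lambda>p. norm (fst p)) ` S m)" if m: "m > 0" for m
  proof -
    obtain C where "\<forall>p\<in>S m. norm p \<le> C" using bnd[OF m] unfolding S_def bounded_iff by (rule exE)
    then show ?thesis by (intro bdd_aboveI2[where M = C]) (metis norm_fst_le order_trans prod.collapse)
  qed
  have upper: "norm (fst p) \<le> r m" if "m > 0" "p \<in> S m" for m p
    using that bdd[OF that(1)] by (auto simp: r_def intro!: cSup_upper)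
  have zero: "(0, 0) \<in> S m" if "m > 0" for m using that V_zero by (simp add: S_def)
  have nn: "0 \<le> r m" for m
    using upper[OF _ zero, of m] by (cases "m \<le> 0") (auto simp: r_def)
  have "mono r"
  proof (rule monoI)
    fix m m' :: real assume mm: "m \<le> m'"
    show "r m \<le> r m'"
    proof (cases "m \<le> 0")
      case True
      then have "r m = 0" by (simp add: r_def)
      then show ?thesis using nn[of m'] by simp
    next
      case False
      have "(\<lambda>p. norm (fst p)) ` S m \<subseteq> (\<lambda>p. norm (fst p)) ` S m'" using mm by (intro image_mono) (auto simp: S_def)
      then have "Sup ((\<lambda>p. norm (fst p)) ` S m) \<le> Sup ((\<lambda>p. norm (fst p)) ` S m')"
        using False mm zero[of m] bdd[of m'] by (intro cSup_subset_mono) auto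
      then show ?thesis using False mm by (simp add: r_def)
    qed
  qed
  from mono_continuous_majorant[OF this]
  obtain R where R: "continuous_on UNIV R" "\<And>m. r m \<le> R m" by blast
  show ?thesis
  proof (rule that[OF R(1)])
    show "0 \<le> R m" for m using nn[of m] R(2)[of m] by simp
    fix m z :: real and \<xi> assume "0 < m" "\<bar>z\<bar> \<le> m" "V \<xi> z \<le> m"
    then have "norm (fst (\<xi>, z)) \<le> r m" by (intro upper) (auto simp: S_def)
    then show "norm \<xi> \<le> R m" using R(2)[of m] by simp
  qed
qed

section \<open>Uniqueness and global existence\<close>

text \<open>Both trajectories stay in one ball, where the vector field is Lipschitz; the distance
  between them then satisfies the Gronwall inequality with zero initial value.\<close>

lemma solution_unique:
  assumes adm: "admissible n1 n2 \<theta> d"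
    and x: "primitive_on 0 T x (\<lambda>s. F (\<theta> s) (d s) (x s))"
    and y: "primitive_on 0 T y (\<lambda>s. F (\<theta> s) (d s) (y s))"
    and init: "x 0 = y 0" and t: "t \<in> {0..T}"
  shows "x t = y t"
proof -
  have xc: "continuous_on {0..T} x" and yc: "continuous_on {0..T} y"
    using primitive_on_continuous x y by auto
  have "compact (x ` {0..T} \<union> y ` {0..T})"
    using xc yc by (intro compact_Un compact_continuous_image) auto
  then have "bounded (x ` {0..T} \<union> y ` {0..T})" by (rule compact_imp_bounded)
  then obtain r where r: "\<forall>v\<in>x ` {0..T} \<union> y ` {0..T}. norm v \<le> r" unfolding bounded_iff by (rule exE)
  obtain L where L: "L > 0" "\<And>x y th dd. norm x \<le> r \<Longrightarrow> norm y \<le> r \<Longrightarrow> th \<in> \<Theta> \<Longrightarrow> dd \<in> D \<Longrightarrow>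
    norm th \<le> max n1 n2 \<Longrightarrow> norm dd \<le> max n1 n2 \<Longrightarrow> norm (F th dd x - F th dd y) \<le> L * norm (x - y)"
    using rhs_lipschitz[of r "max n1 n2"] by blast
  have hc: "continuous_on {0..T} (\<lambda>s. norm (x s - y s))" using xc yc by (intro continuous_intros)
  have "norm (x t - y t) = 0"
  proof (rule integral_le_imp_zero[OF hc _ less_imp_le[OF L(1)] _ t])
    fix s assume s: "s \<in> {0..T}"
    have hi: "(\<lambda>u. norm (x u - y u)) integrable_on {0..s}"
      using s by (intro integrable_continuous_real continuous_on_subset[OF hc]) auto
    have "x s - y s = integral {0..s} (\<lambda>u. F (\<theta> u) (d u) (x u)) - integral {0..s} (\<lambda>u. F (\<theta> u) (d u) (y u))"
      using primitive_onD(3)[OF x s] primitive_onD(3)[OF y s] init by simp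
    also have "\<dots> = integral {0..s} (\<lambda>u. F (\<theta> u) (d u) (x u) - F (\<theta> u) (d u) (y u))"
      using s by (intro integral_diff[symmetric] primitive_onD(1)[OF primitive_on_subinterval[OF x]]
          primitive_onD(1)[OF primitive_on_subinterval[OF y]]) auto
    finally have eq: "x s - y s = integral {0..s} (\<lambda>u. F (\<theta> u) (d u) (x u) - F (\<theta> u) (d u) (y u))" .
    have "norm (x s - y s) \<le> integral {0..s} (\<lambda>u. L * norm (x u - y u))"
      unfolding eq
    proof (rule integral_norm_bound_integral)
      show "(\<lambda>u. F (\<theta> u) (d u) (x u) - F (\<theta> u) (d u) (y u)) integrable_on {0..s}"
        using s by (intro integrable_diff primitive_onD(1)[OF primitive_on_subinterval[OF x]]
          primitive_onD(1)[OF primitive_on_subinterval[OF y]]) auto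
      show "(\<lambda>u. L * norm (x u - y u)) integrable_on {0..s}" using hi by (intro integrable_on_mult_right)
      fix u assume u: "u \<in> {0..s}"
      then have "norm (x u) \<le> r" "norm (y u) \<le> r" using r s by auto
      then show "norm (F (\<theta> u) (d u) (x u) - F (\<theta> u) (d u) (y u)) \<le> L * norm (x u - y u)"
        using admissibleD[OF adm, of u] u by (intro L(2)) auto
    qed
    then show "norm (x s - y s) \<le> L * integral {0..s} (\<lambda>u. norm (x u - y u))" by simp
  qed simp
  then show ?thesis by simp
qed

text \<open>Projecting the state onto the ball of radius \<open>r + 1\<close> makes the vector field
  globally bounded and Lipschitz. The a priori bound \<open>r\<close> prevents the trajectory from
  reaching the boundary of that ball, so the projection never acts.\<close>

lemma solution_exists:
  assumes adm: "admissible n1 n2 \<theta> d"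
    and apriori: "\<And>x T. 0 \<le> T \<Longrightarrow> x 0 = x0 \<Longrightarrow> primitive_on 0 T x (\<lambda>s. F (\<theta> s) (d s) (x s)) \<Longrightarrow> norm (x T) \<le> r"
  obtains x where "x 0 = x0" "\<And>T. primitive_on 0 T x (\<lambda>s. F (\<theta> s) (d s) (x s))"
proof -
  define Q where "Q = cball (0 :: 'a \<times> real) (r + 1)"
  \<comment> \<open>The degenerate interval \<open>[0, 0]\<close> puts \<open>x0\<close> itself
    under the a priori bound, which also shows \<open>r \<ge> 0\<close>.\<close>
  have "primitive_on 0 0 (\<lambda>_. x0) (\<lambda>s. F (\<theta> s) (d s) x0)"
    by (rule primitive_onI) (use integrable_on_refl[of _ "0::real"] in auto)
  then have "norm x0 \<le> r" using apriori[of 0 "\<lambda>_. x0"] by simp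
  then have r: "0 \<le> r" using norm_ge_zero[of x0] by linarith
  have Q: "convex Q" "closed Q" "Q \<noteq> {}" using r by (auto simp: Q_def)
  define P where "P = closest_point Q"
  have PQ: "norm (P y) \<le> r + 1" for y
    using closest_point_in_set[OF Q(2,3), of y] by (simp add: P_def Q_def)
  have Pid: "P y = y" if "norm y \<le> r + 1" for y
    using that by (simp add: P_def Q_def closest_point_self)
  have Plip: "norm (P y - P y') \<le> norm (y - y')" for y y'
    using closest_point_lipschitz[OF Q, of y y'] by (simp add: P_def dist_norm)
  have Pc: "continuous_on UNIV P" unfolding P_def by (rule continuous_on_closest_point[OF Q])
  obtain C where C: "\<And>x th dd. norm x \<le> r + 1 \<Longrightarrow> th \<in> \<Theta> \<Longrightarrow> dd \<in> D \<Longrightarrow> norm th \<le> max n1 n2 \<Longrightarrow>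
      norm dd \<le> max n1 n2 \<Longrightarrow> norm (F th dd x) \<le> C"
    using rhs_bounded[of "r + 1" "max n1 n2"] by blast
  obtain L where L: "L > 0" "\<And>x y th dd. norm x \<le> r + 1 \<Longrightarrow> norm y \<le> r + 1 \<Longrightarrow> th \<in> \<Theta> \<Longrightarrow> dd \<in> D \<Longrightarrow>
    norm th \<le> max n1 n2 \<Longrightarrow> norm dd \<le> max n1 n2 \<Longrightarrow> norm (F th dd x - F th dd y) \<le> L * norm (x - y)"
    using rhs_lipschitz[of "r + 1" "max n1 n2"] by blast
  have "\<exists>x. continuous_on UNIV x \<and> (\<forall>t\<ge>0. x t = x0 + integral {0..t} (\<lambda>s. F (\<theta> s) (d s) (P (x s))))"
  proof (rule Picard_global[of "\<lambda>t y. F (\<theta> t) (d t) (P y)" C L x0])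
    fix t :: real and y y' assume t: "0 \<le> t"
    show "norm (F (\<theta> t) (d t) (P y)) \<le> C" using admissibleD[OF adm t] PQ by (intro C) auto
    have "norm (F (\<theta> t) (d t) (P y) - F (\<theta> t) (d t) (P y')) \<le> L * norm (P y - P y')"
      using admissibleD[OF adm t] PQ by (intro L(2)) auto
    also have "\<dots> \<le> L * norm (y - y')" using L(1) Plip by (intro mult_left_mono) auto
    finally show "norm (F (\<theta> t) (d t) (P y) - F (\<theta> t) (d t) (P y')) \<le> L * norm (y - y')" .
  next
    fix x :: "real \<Rightarrow> 'a \<times> real" and t :: real assume "continuous_on UNIV x" "0 \<le> t"
    then show "(\<lambda>s. F (\<theta> s) (d s) (P (x s))) integrable_on {0..t}"
      by (intro rhs_integrable[OF adm] continuous_on_compose2[OF Pc]) (auto intro: continuous_on_subset)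
  qed (use L in auto)
  then obtain x where x: "continuous_on UNIV x"
    "\<And>t. t \<ge> 0 \<Longrightarrow> x t = x0 + integral {0..t} (\<lambda>s. F (\<theta> s) (d s) (P (x s)))" by blast
  have x0: "x 0 = x0" using x(2)[of 0] by simp
  \<comment> \<open>Staying inside before \<open>T\<close> is enough, as the endpoint is a null set;
    this permits \<open>T\<close> to be the first exit time.\<close>
  have prim: "primitive_on 0 T x (\<lambda>s. F (\<theta> s) (d s) (x s))"
    if inside: "\<And>s. 0 \<le> s \<Longrightarrow> s < T \<Longrightarrow> norm (x s) \<le> r + 1" for T
  proof (rule primitive_onI)
    have xT: "continuous_on {0..T} x" by (rule continuous_on_subset[OF x(1)]) simp
    show "(\<lambda>s. F (\<theta> s) (d s) (x s)) integrable_on {0..T}"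
      "bounded ((\<lambda>s. F (\<theta> s) (d s) (x s)) ` {0..T})" by (rule rhs_integrable[OF adm xT])+
    fix s assume s: "s \<in> {0..T}"
    have "integral {0..s} (\<lambda>s. F (\<theta> s) (d s) (P (x s))) = integral {0..s} (\<lambda>s. F (\<theta> s) (d s) (x s))"
      using s inside Pid by (intro integral_spike[of "{T}"]) auto
    then show "x s = x 0 + integral {0..s} (\<lambda>s. F (\<theta> s) (d s) (x s))" using x(2)[of s] x0 s by simp
  qed
  \<comment> \<open>At the first exit time the truncated trajectory still solves the original
    system, so its norm is at most \<open>r\<close> there, against \<open>r + 1\<close> by the
    choice of that time.\<close>
  have inside: "norm (x t) < r + 1" if t: "0 \<le> t" for t
  proof (rule ccontr)
    assume "\<not> norm (x t) < r + 1"
    let ?E = "{0..} \<inter> (\<lambda>s. norm (x s)) -` {r + 1..}"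
    have ne: "?E \<noteq> {}" using t \<open>\<not> norm (x t) < r + 1\<close> by auto
    have bd: "bdd_below ?E" by (rule bdd_belowI[of _ 0]) auto
    have "closed ?E"
      by (intro continuous_closed_preimage continuous_intros continuous_on_subset[OF x(1)]) auto
    then have E: "Inf ?E \<in> ?E" by (rule closed_contains_Inf[OF ne bd])
    have "primitive_on 0 (Inf ?E) x (\<lambda>s. F (\<theta> s) (d s) (x s))"
    proof (rule prim)
      fix s assume s: "0 \<le> s" "s < Inf ?E"
      then have "s \<notin> ?E" using cInf_lower[OF _ bd, of s] by auto
      then show "norm (x s) \<le> r + 1" using s by auto
    qed
    then have "norm (x (Inf ?E)) \<le> r" using E x0 by (intro apriori[of "Inf ?E" x]) auto
    then show False using E by auto
  qed
  show ?thesis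
    by (rule that[OF x0 prim]) (use inside in \<open>auto intro: less_imp_le\<close>)
qed

text \<open>Explicit bounds in the data: \<open>M\<close> for \<open>U\<close> by comparison,
  \<open>Y\<close> for the level of \<open>exp z\<close> beyond which the gain is small,
  \<open>Z\<close> for \<open>z\<close>, and then \<open>R\<close> for \<open>\<xi>\<close>. Each is
  continuous in the initial state and the input bounds.\<close>

lemma bound_function:
  assumes cmp: "comparison_pair \<rho> \<sigma> \<gamma>" and \<sigma>: "class_KL \<sigma>" and \<gamma>: "class_Kinf \<gamma>"
  obtains B where "continuous_on (UNIV \<times> UNIV \<times> {0..} \<times> {0..}) (\<lambda>(x, z, s1, s2). B x z s1 s2)"
    "\<And>n1 n2 \<theta> d x T. admissible n1 n2 \<theta> d \<Longrightarrow> 0 \<le> T \<Longrightarrow>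
       primitive_on 0 T x (\<lambda>s. F (\<theta> s) (d s) (x s)) \<Longrightarrow>
       norm (fst (x T)) \<le> B (fst (x 0)) (snd (x 0)) n1 n2 \<and> snd (x T) \<le> B (fst (x 0)) (snd (x 0)) n1 n2"
proof -
  have \<rho>\<epsilon>: "\<rho> \<epsilon> > 0" using class_Kinf_pos[OF K(3) \<epsilon>] .
  obtain \<kappa>i where \<kappa>i: "class_Kinf \<kappa>i" "\<And>s. s \<ge> 0 \<Longrightarrow> \<kappa>i s \<ge> 0" "\<And>s. s \<ge> 0 \<Longrightarrow> \<kappa> (\<kappa>i s) = s"
    using class_Kinf_inverse[OF K(1)] by blast
  obtain R where R: "continuous_on UNIV R" "\<And>m. 0 \<le> R m"
    "\<And>m \<xi> z. 0 < m \<Longrightarrow> \<bar>z\<bar> \<le> m \<Longrightarrow> V \<xi> z \<le> m \<Longrightarrow> norm \<xi> \<le> R m"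
    using sublevel_radius by blast
  have \<sigma>0: "class_K (\<lambda>s. \<sigma> s 0)" using \<sigma> by (simp add: class_KL_def)
  have \<sigma>0_nonneg: "0 \<le> \<sigma> s 0" if "s \<ge> 0" for s
    using \<sigma>0 that strict_mono_on_leD[of "{0..}" "\<lambda>s. \<sigma> s 0" 0 s] by (auto simp: class_K_def)
  have \<sigma>_le: "\<sigma> s t \<le> \<sigma> s 0" if "s \<ge> 0" "t \<ge> 0" for s t
    using \<sigma> that by (simp add: class_KL_def)
  define M where "M x z s1 s2 = \<sigma> (V x z) 0 + \<gamma> (gain s1 s2 (exp z))" for x z s1 s2
  define Y where "Y z s1 s2 = exp z + \<kappa>i (2 * a * (s1\<^sup>2 + s2\<^sup>2) / \<rho> \<epsilon>)" for z s1 s2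
  define Z where "Z x z s1 s2 = ln (Y z s1 s2 + \<Gamma> * (M x z s1 s2)\<^sup>2 / \<rho> \<epsilon>)" for x z s1 s2
  \<comment> \<open>The level passed to \<open>R\<close> is positive and exceeds \<open>M\<close> as
    well as the absolute value of every \<open>z\<close> between the initial one and
    \<open>Z\<close>. The first summand makes \<open>B\<close> a bound for \<open>z\<close>
    too.\<close>
  define B where "B x z s1 s2 = \<bar>Z x z s1 s2\<bar> + R (1 + M x z s1 s2 + \<bar>z\<bar> + \<bar>Z x z s1 s2\<bar>)" for x z s1 s2
  have V_nonneg: "0 \<le> V x z" for x z using U_nonneg[of "(x, z)"] by simp
  have M0: "0 \<le> M x z s1 s2" for x z s1 s2
    unfolding M_def by (intro add_nonneg_nonneg \<sigma>0_nonneg class_Kinf_nonneg[OF \<gamma>] gain_nonneg V_nonneg)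
  have q0: "0 \<le> 2 * a * (s1\<^sup>2 + s2\<^sup>2) / \<rho> \<epsilon>" for s1 s2 using a \<rho>\<epsilon> by simp
  have YZ: "0 < Y z s1 s2 + \<Gamma> * (M x z s1 s2)\<^sup>2 / \<rho> \<epsilon>" for x z s1 s2
    unfolding Y_def using \<kappa>i(2)[OF q0] \<Gamma> \<rho>\<epsilon> by (intro add_pos_nonneg) auto
  let ?A = "UNIV \<times> UNIV \<times> {0..} \<times> {0..} :: ('a \<times> real \<times> real \<times> real) set"
  let ?x = "\<lambda>p :: 'a \<times> real \<times> real \<times> real. fst p" and ?z = "\<lambda>p :: 'a \<times> real \<times> real \<times> real. fst (snd p)"
    and ?s1 = "\<lambda>p :: 'a \<times> real \<times> real \<times> real. fst (snd (snd p))"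
    and ?s2 = "\<lambda>p :: 'a \<times> real \<times> real \<times> real. snd (snd (snd p))"
  have "continuous_on ?A (\<lambda>p. U (?x p, ?z p))"
    by (rule continuous_on_compose2[OF U_cont[of UNIV]]) (auto intro!: continuous_intros)
  then have Vc: "continuous_on ?A (\<lambda>p. V (?x p) (?z p))" by simp
  have "continuous_on {0..} (\<lambda>s. \<sigma> s 0)" using \<sigma>0 by (simp add: class_K_def)
  from continuous_on_compose2[OF this Vc] have c1: "continuous_on ?A (\<lambda>p. \<sigma> (V (?x p) (?z p)) 0)"
    using V_nonneg by blast
  have "continuous_on ?A (\<lambda>p. gain (?s1 p) (?s2 p) (exp (?z p)))"
    by (rule continuous_on_chi[OF K(2,1)]) (auto intro!: continuous_intros)
  from continuous_on_compose2[OF class_Kinf_continuous[OF \<gamma>] this]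
  have c2: "continuous_on ?A (\<lambda>p. \<gamma> (gain (?s1 p) (?s2 p) (exp (?z p))))"
    using gain_nonneg by blast
  have Mc: "continuous_on ?A (\<lambda>p. M (?x p) (?z p) (?s1 p) (?s2 p))"
    unfolding M_def by (intro continuous_intros c1 c2)
  have "continuous_on ?A (\<lambda>p. 2 * a * ((?s1 p)\<^sup>2 + (?s2 p)\<^sup>2) / \<rho> \<epsilon>)"
    using \<rho>\<epsilon> by (intro continuous_intros) auto
  from continuous_on_compose2[OF class_Kinf_continuous[OF \<kappa>i(1)] this]
  have "continuous_on ?A (\<lambda>p. \<kappa>i (2 * a * ((?s1 p)\<^sup>2 + (?s2 p)\<^sup>2) / \<rho> \<epsilon>))"
    using q0 by blast
  then have Yc: "continuous_on ?A (\<lambda>p. Y (?z p) (?s1 p) (?s2 p))"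
    unfolding Y_def by (intro continuous_intros)
  have Zc: "continuous_on ?A (\<lambda>p. Z (?x p) (?z p) (?s1 p) (?s2 p))"
    unfolding Z_def using YZ \<rho>\<epsilon> by (intro continuous_intros Mc Yc) (auto simp: less_imp_neq[symmetric])
  have "continuous_on ?A (\<lambda>p. B (?x p) (?z p) (?s1 p) (?s2 p))"
    unfolding B_def by (intro continuous_intros Mc Zc continuous_on_compose2[OF R(1)]) auto
  then have Bc: "continuous_on ?A (\<lambda>(x, z, s1, s2). B x z s1 s2)" by (simp add: case_prod_unfold)
  show ?thesis
  proof (rule that[OF Bc])
    fix n1 n2 T :: real and \<theta> d x
    assume adm: "admissible n1 n2 \<theta> d" and T: "0 \<le> T"
      and x: "primitive_on 0 T x (\<lambda>s. F (\<theta> s) (d s) (x s))"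
    let ?\<xi>0 = "fst (x 0)" and ?z0 = "snd (x 0)"
    let ?M = "M ?\<xi>0 ?z0 n1 n2" and ?Y = "Y ?z0 n1 n2" and ?Z = "Z ?\<xi>0 ?z0 n1 n2"
    have UM: "U (x s) \<le> ?M" if s: "s \<in> {0..T}" for s
    proof -
      have "U (x s) \<le> \<sigma> (U (x 0)) (s - 0) + \<gamma> (gain n1 n2 (exp ?z0))"
      proof (rule U_comparison[OF cmp adm _ _ _ negligible_empty])
        show "primitive_on 0 s x (\<lambda>s. F (\<theta> s) (d s) (x s))"
          using s by (intro primitive_on_subinterval[OF x]) auto
        show "norm (d t) \<le> n1 \<and> norm (\<theta> t) \<le> n2" if "t \<in> {0..s} - {}" for t
          using admissibleD[OF adm, of t] that by simp
      qed (use s in auto)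
      also have "\<sigma> (U (x 0)) (s - 0) \<le> \<sigma> (U (x 0)) 0" using s by (intro \<sigma>_le U_nonneg) auto
      finally show ?thesis by (simp add: M_def)
    qed
    have n: "0 \<le> n1" "0 \<le> n2" using admissibleD(7,8)[OF adm order_refl] by auto
    have "exp (snd (x T)) \<le> ?Y + \<Gamma> * ?M\<^sup>2 / \<rho> \<epsilon>"
    proof (rule exp_z_bound[OF adm T x UM M0])
      show "exp ?z0 \<le> ?Y" using \<kappa>i(2)[OF q0] by (simp add: Y_def)
      fix y assume "?Y \<le> y"
      then have "0 < y" "\<kappa>i (2 * a * (n1\<^sup>2 + n2\<^sup>2) / \<rho> \<epsilon>) \<le> y"
        using \<kappa>i(2)[OF q0, of n1 n2] exp_gt_zero[of ?z0] unfolding Y_def by linarith+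
      then show "gain n1 n2 y \<le> \<rho> \<epsilon> / 2" by (intro gain_small[OF \<kappa>i(2,3) n])
    qed
    then have "ln (exp (snd (x T))) \<le> ?Z"
      unfolding Z_def using YZ by (subst ln_le_cancel_iff) auto
    then have zZ: "snd (x T) \<le> ?Z" by simp
    have "?z0 \<le> snd (x T)" by (rule z_mono[OF x T])
    then have "norm (fst (x T)) \<le> R (1 + ?M + \<bar>?z0\<bar> + \<bar>?Z\<bar>)"
      using UM[of T] T zZ M0[of ?\<xi>0 ?z0 n1 n2] by (intro R(3)[of _ "snd (x T)"]) auto
    then show "norm (fst (x T)) \<le> B ?\<xi>0 ?z0 n1 n2 \<and> snd (x T) \<le> B ?\<xi>0 ?z0 n1 n2"
      using zZ R(2)[of "1 + ?M + \<bar>?z0\<bar> + \<bar>?Z\<bar>"] unfolding B_def by linarith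
  qed
qed

section \<open>Asymptotic estimates\<close>

text \<open>Since \<open>U\<close> rises at rate at most \<open>X\<close>, a value well above
  \<open>\<epsilon>\<close> at time \<open>t\<close> forces an excess on a whole window before
  \<open>t\<close>. There \<open>exp z\<close> would gain a fixed amount, which its convergence
  excludes at late times.\<close>

lemma limsup_U_le_eps:
  assumes adm: "admissible n1 n2 \<theta> d"
    and x: "\<And>T. primitive_on 0 T x (\<lambda>s. F (\<theta> s) (d s) (x s))"
    and zinf: "((\<lambda>t. snd (x t)) \<longlongrightarrow> zinf) at_top" "\<And>t. t \<ge> 0 \<Longrightarrow> snd (x t) \<le> zinf"
  shows "Limsup at_top (\<lambda>t. ereal (U (x t))) \<le> ereal \<epsilon>"
proof (rule ereal_le_epsilon2)
  fix \<eta> :: real assume \<eta>: "0 < \<eta>"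
  define X where "X = gain n1 n2 (exp (snd (x 0)))"
  have X: "0 \<le> X" unfolding X_def by (rule gain_nonneg)
  \<comment> \<open>The window is short enough that \<open>U\<close> rises by at most
    \<open>\<eta> / 2\<close> across it; \<open>X + 1\<close> avoids a zero denominator.\<close>
  define \<Delta> where "\<Delta> = \<eta> / (2 * (X + 1))"
  have \<Delta>: "\<Delta> > 0" "X * \<Delta> \<le> \<eta> / 2" using X \<eta> by (auto simp: \<Delta>_def field_simps)
  have sub: "primitive_on p q x (\<lambda>s. F (\<theta> s) (d s) (x s))" if "0 \<le> p" for p q
    using primitive_on_subinterval[OF x that, of q q] by simp
  have U_slow: "U (x t) \<le> U (x s) + X * (t - s)" if st: "0 \<le> s" "s \<le> t" for s t
  proof (rule primitive_on_mono[OF primitive_on_U[OF sub[OF st(1)]] st(2) negligible_empty])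
    fix u assume u: "u \<in> {s..t} - {}"
    then have u0: "0 \<le> u" using st by auto
    have "gain (norm (d u)) (norm (\<theta> u)) (exp (snd (x u))) \<le> X"
      unfolding X_def using admissibleD[OF adm u0] a K z_mono[OF x u0] by (intro chi_mono) auto
    then show "DU (x u) \<bullet> F (\<theta> u) (d u) (x u) \<le> X"
      using U_decay[of "\<theta> u" "d u" "x u"] rho_nonneg[of "x u"] admissibleD[OF adm u0] by auto
  qed
  have "((\<lambda>t. exp (snd (x t))) \<longlongrightarrow> exp zinf) at_top" by (intro tendsto_intros zinf)
  then have "\<forall>\<^sub>F t in at_top. exp zinf - \<Gamma> * \<Delta> * (\<eta> / 2) < exp (snd (x t))"
    using \<Gamma> \<Delta> \<eta> by (intro order_tendstoD(1)) auto
  then obtain T0 where T0: "\<And>t. t \<ge> T0 \<Longrightarrow> exp zinf - \<Gamma> * \<Delta> * (\<eta> / 2) < exp (snd (x t))"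
    unfolding eventually_at_top_linorder by blast
  have "U (x t) \<le> \<epsilon> + \<eta>" if t: "t \<ge> max T0 0 + \<Delta>" for t
  proof -
    have p: "0 \<le> t - \<Delta>" "t - \<Delta> \<le> t" "T0 \<le> t - \<Delta>" using t \<Delta> by auto
    have "\<Gamma> * (U (x t) - \<epsilon> - \<eta> / 2) * (t - (t - \<Delta>)) \<le> exp (snd (x t)) - exp (snd (x (t - \<Delta>)))"
    proof (rule exp_z_growth[OF sub[OF p(1)] p(2)])
      fix s assume s: "s \<in> {t - \<Delta>..t}"
      have "X * (t - s) \<le> X * \<Delta>" using s X by (intro mult_left_mono) auto
      then show "U (x t) - \<epsilon> - \<eta> / 2 \<le> U (x s) - \<epsilon>" using U_slow[of s t] s p \<Delta>(2) by auto
    qed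
    also have "\<dots> < \<Gamma> * \<Delta> * (\<eta> / 2)"
    proof -
      have "exp (snd (x t)) \<le> exp zinf" using zinf(2)[of t] p by simp
      then show ?thesis using T0[OF p(3)] by linarith
    qed
    finally have "\<Gamma> * \<Delta> * (U (x t) - \<epsilon> - \<eta> / 2) < \<Gamma> * \<Delta> * (\<eta> / 2)" by (simp add: mult_ac)
    then have "U (x t) - \<epsilon> - \<eta> / 2 < \<eta> / 2" using \<Gamma> \<Delta>(1) by (subst (asm) mult_less_cancel_left_pos) auto
    then show ?thesis by simp
  qed
  then have "\<forall>\<^sub>F t in at_top. ereal (U (x t)) \<le> ereal \<epsilon> + ereal \<eta>"
    unfolding eventually_at_top_linorder by auto
  then show "Limsup at_top (\<lambda>t. ereal (U (x t))) \<le> ereal \<epsilon> + ereal \<eta>" by (rule Limsup_bounded)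
qed

text \<open>The comparison is restarted at a time after which the inputs are almost always within
  \<open>\<eta>\<close> of their asymptotic bounds and \<open>z\<close> is within
  \<open>\<eta>\<close> of its limit. The transient dies out, and continuity removes the
  margin.\<close>

lemma limsup_U_le_gain:
  assumes cmp: "comparison_pair \<rho> \<sigma> \<gamma>" and \<gamma>: "continuous_on {0..} \<gamma>"
    and \<sigma>: "\<And>s. s \<ge> 0 \<Longrightarrow> (\<sigma> s \<longlongrightarrow> 0) at_top"
    and adm: "admissible n1 n2 \<theta> d"
    and x: "\<And>T. primitive_on 0 T x (\<lambda>s. F (\<theta> s) (d s) (x s))"
    and zinf: "((\<lambda>t. snd (x t)) \<longlongrightarrow> zinf) at_top"
    and tail_d: "\<And>\<eta>. \<eta> > 0 \<Longrightarrow> \<exists>T\<ge>0. negligible {t \<in> {T..}. m1 + \<eta> < norm (d t)}"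
    and tail_\<theta>: "\<And>\<eta>. \<eta> > 0 \<Longrightarrow> \<exists>T\<ge>0. negligible {t \<in> {T..}. m2 + \<eta> < norm (\<theta> t)}"
  shows "Limsup at_top (\<lambda>t. ereal (U (x t))) \<le> ereal (\<gamma> (gain m1 m2 (exp zinf)))"
proof (rule ereal_le_epsilon2)
  fix e :: real assume e: "0 < e"
  \<comment> \<open>The gain with all three margins; \<open>g 0\<close> is the target. Half of
    \<open>e\<close> is reserved for the margin and half for the transient.\<close>
  define g where "g \<eta> = \<gamma> (gain (m1 + \<eta>) (m2 + \<eta>) (exp (zinf - \<eta>)))" for \<eta>
  have "continuous_on UNIV (\<lambda>\<eta>. gain (m1 + \<eta>) (m2 + \<eta>) (exp (zinf - \<eta>)))"
    by (rule continuous_on_chi[OF K(2,1)]) (auto intro!: continuous_intros)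
  from continuous_on_compose2[OF \<gamma> this] have "continuous_on UNIV g"
    unfolding g_def using gain_nonneg by blast
  then have "(g \<longlongrightarrow> g 0) (at 0)" by (simp add: continuous_on_eq_continuous_at isCont_def)
  then have "(g \<longlongrightarrow> g 0) (at_right 0)" by (rule tendsto_within_subset) simp
  then have "\<forall>\<^sub>F \<eta> in at_right 0. g \<eta> < g 0 + e / 2" using e by (intro order_tendstoD(2)) auto
  moreover have "\<forall>\<^sub>F \<eta> in at_right (0::real). 0 < \<eta>" by (simp add: eventually_at_right_less)
  ultimately have "\<forall>\<^sub>F \<eta> in at_right 0. 0 < \<eta> \<and> g \<eta> < g 0 + e / 2" by eventually_elim simp
  from eventually_happens'[OF trivial_limit_at_right_real this]
  obtain \<eta> where \<eta>: "\<eta> > 0" "g \<eta> < g 0 + e / 2" by blast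
  obtain T1 where T1: "T1 \<ge> 0" "negligible {t \<in> {T1..}. m1 + \<eta> < norm (d t)}" using tail_d[OF \<eta>(1)] by blast
  obtain T2 where T2: "T2 \<ge> 0" "negligible {t \<in> {T2..}. m2 + \<eta> < norm (\<theta> t)}" using tail_\<theta>[OF \<eta>(1)] by blast
  have "\<forall>\<^sub>F t in at_top. zinf - \<eta> < snd (x t)" using \<eta> by (intro order_tendstoD(1)[OF zinf]) auto
  then obtain T3 where T3: "\<And>t. t \<ge> T3 \<Longrightarrow> zinf - \<eta> < snd (x t)"
    unfolding eventually_at_top_linorder by blast
  define T where "T = max T1 (max T2 T3)"
  define N where "N = {t \<in> {T1..}. m1 + \<eta> < norm (d t)} \<union> {t \<in> {T2..}. m2 + \<eta> < norm (\<theta> t)}"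
  have T: "0 \<le> T" "T1 \<le> T" "T2 \<le> T" "T3 \<le> T" using T1 by (auto simp: T_def)
  have N: "negligible N" using T1 T2 by (simp add: N_def)
  have U_le: "U (x t) \<le> \<sigma> (U (x T)) (t - T) + g \<eta>" if t: "t \<ge> T" for t
    unfolding g_def
  proof (rule U_comparison[OF cmp adm _ T(1) t N])
    show "primitive_on T t x (\<lambda>s. F (\<theta> s) (d s) (x s))"
      using primitive_on_subinterval[OF x T(1) order_refl] .
    show "norm (d s) \<le> m1 + \<eta> \<and> norm (\<theta> s) \<le> m2 + \<eta>" if "s \<in> {T..t} - N" for s
      using that T unfolding N_def by force
    show "zinf - \<eta> \<le> snd (x T)" using T3[OF T(4)] by simp
  qed
  have "((\<lambda>t. \<sigma> (U (x T)) (t - T)) \<longlongrightarrow> 0) at_top"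
    by (rule filterlim_compose[OF \<sigma>[OF U_nonneg]])
      (use filterlim_tendsto_add_at_top[OF tendsto_const[of "- T"] filterlim_ident] in simp)
  then have "\<forall>\<^sub>F t in at_top. \<sigma> (U (x T)) (t - T) < e / 2" using e by (intro order_tendstoD(2)) auto
  then have "\<forall>\<^sub>F t in at_top. ereal (U (x t)) \<le> ereal (g 0) + ereal e"
    using eventually_ge_at_top[of T]
  proof eventually_elim
    case (elim t)
    then have "U (x t) \<le> g 0 + e" using U_le[of t] \<eta>(2) by linarith
    then show ?case by simp
  qed
  then show "Limsup at_top (\<lambda>t. ereal (U (x t))) \<le> ereal (\<gamma> (gain m1 m2 (exp zinf))) + ereal e"
    unfolding g_def by (intro Limsup_bounded) simp
qed

section \<open>Passage to essentially bounded inputs and conclusion\<close>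

text \<open>Zero is an allowed value of both inputs, so values beyond the essential norm, which
  occur only on a null set, may be reset to it.\<close>

lemma truncated_inputs:
  assumes \<theta>: "Linf_input \<Theta> \<theta>" and d: "Linf_input D d"
    and n1: "n1 = real_of_ereal (ess_norm d)" and n2: "n2 = real_of_ereal (ess_norm \<theta>)"
  defines "\<theta>' \<equiv> \<lambda>t. if norm (\<theta> t) \<le> n2 then \<theta> t else 0" and "d' \<equiv> \<lambda>t. if norm (d t) \<le> n1 then d t else 0"
  shows "admissible n1 n2 \<theta>' d'" "negligible {t \<in> {0..}. \<theta> t \<noteq> \<theta>' t \<or> d t \<noteq> d' t}"
proof -
  have [measurable]: "\<theta> \<in> borel_measurable (restrict_space lborel {0..})"
    "d \<in> borel_measurable (restrict_space lborel {0..})"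
    using \<theta> d by (auto simp: Linf_input_def)
  have "\<theta>' \<in> borel_measurable (restrict_space lborel {0..})" "d' \<in> borel_measurable (restrict_space lborel {0..})"
    unfolding \<theta>'_def d'_def by measurable
  moreover have "0 \<le> n1" "0 \<le> n2" unfolding n1 n2 using Linf_input_ess_norm(1) \<theta> d by auto
  ultimately show "admissible n1 n2 \<theta>' d'"
    using \<theta> d \<Theta> D by (auto simp: admissible_def \<theta>'_def d'_def Linf_input_def)
  have "negligible ({t \<in> {0..}. n1 < norm (d t)} \<union> {t \<in> {0..}. n2 < norm (\<theta> t)})"
    unfolding n1 n2 by (intro negligible_Un Linf_input_ess_norm(2)[OF \<theta>] Linf_input_ess_norm(2)[OF d])
  then show "negligible {t \<in> {0..}. \<theta> t \<noteq> \<theta>' t \<or> d t \<noteq> d' t}"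
    by (rule negligible_subset) (auto simp: \<theta>'_def d'_def)
qed

text \<open>The bound \<open>B\<close> is built from one fixed pair, while the gain and decay
  estimates may come from any other pair. Hence one \<open>B\<close> serves both the general
  statement and the linear refinement.\<close>

lemma conclusion_of_comparison:
  assumes cmp0: "comparison_pair \<rho> \<sigma>0 \<gamma>0" and \<sigma>0: "class_KL \<sigma>0" and \<gamma>0: "class_Kinf \<gamma>0"
  obtains B where "continuous_on (UNIV \<times> UNIV \<times> {0..} \<times> {0..}) (\<lambda>(x, z, s1, s2). B x z s1 s2)"
    "\<And>\<sigma> \<gamma>. comparison_pair \<rho> \<sigma> \<gamma> \<Longrightarrow> continuous_on {0..} \<gamma> \<Longrightarrow> (\<And>s. s \<ge> 0 \<Longrightarrow> (\<sigma> s \<longlongrightarrow> 0) at_top) \<Longrightarrow>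
       conclusion_holds f V \<Gamma> \<epsilon> \<Theta> D a b lam \<kappa> B \<gamma> \<sigma>"
proof -
  obtain B where B: "continuous_on (UNIV \<times> UNIV \<times> {0..} \<times> {0..}) (\<lambda>(x, z, s1, s2). B x z s1 s2)"
    and B_bound: "\<And>n1 n2 \<theta> d x T. admissible n1 n2 \<theta> d \<Longrightarrow> 0 \<le> T \<Longrightarrow>
       primitive_on 0 T x (\<lambda>s. F (\<theta> s) (d s) (x s)) \<Longrightarrow>
       norm (fst (x T)) \<le> B (fst (x 0)) (snd (x 0)) n1 n2 \<and> snd (x T) \<le> B (fst (x 0)) (snd (x 0)) n1 n2"
    using bound_function[OF cmp0 \<sigma>0 \<gamma>0] by blast
  show ?thesis
  proof (rule that[OF B])
    fix \<sigma> \<gamma> assume cmp: "comparison_pair \<rho> \<sigma> \<gamma>" and \<gamma>: "continuous_on {0..} \<gamma>"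
      and \<sigma>: "\<And>s. s \<ge> 0 \<Longrightarrow> (\<sigma> s \<longlongrightarrow> 0) at_top"
    show "conclusion_holds f V \<Gamma> \<epsilon> \<Theta> D a b lam \<kappa> B \<gamma> \<sigma>"
      unfolding conclusion_holds_def Let_def
    proof (intro allI impI, elim conjE)
      fix \<xi>0 :: 'a and z0 :: real and \<theta> d assume \<theta>: "Linf_input \<Theta> \<theta>" and d: "Linf_input D d"
      define n1 n2 where "n1 = real_of_ereal (ess_norm d)" and "n2 = real_of_ereal (ess_norm \<theta>)"
      define \<theta>' d' where "\<theta>' = (\<lambda>t. if norm (\<theta> t) \<le> n2 then \<theta> t else 0)"
        and "d' = (\<lambda>t. if norm (d t) \<le> n1 then d t else 0)"
      have adm: "admissible n1 n2 \<theta>' d'" and N: "negligible {t \<in> {0..}. \<theta> t \<noteq> \<theta>' t \<or> d t \<noteq> d' t}"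
        unfolding \<theta>'_def d'_def by (intro truncated_inputs[OF \<theta> d n1_def n2_def])+
      let ?B = "B \<xi>0 z0 n1 n2"
      \<comment> \<open>The a priori radius adds the bound on \<open>\<xi>\<close> to one on
        \<open>z\<close>, which lies between \<open>z0\<close> and \<open>?B\<close>.\<close>
      obtain x where x0: "x 0 = (\<xi>0, z0)" and x: "\<And>T. primitive_on 0 T x (\<lambda>s. F (\<theta>' s) (d' s) (x s))"
      proof (rule solution_exists[OF adm, of "(\<xi>0, z0)" "?B + (\<bar>z0\<bar> + \<bar>?B\<bar>)"])
        fix x and T :: real
        assume T: "0 \<le> T" and init: "x 0 = (\<xi>0, z0)" and x: "primitive_on 0 T x (\<lambda>s. F (\<theta>' s) (d' s) (x s))"
        have "norm (x T) \<le> norm (fst (x T)) + \<bar>snd (x T)\<bar>"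
          using norm_Pair_le[of "fst (x T)" "snd (x T)"] by simp
        moreover have "norm (fst (x T)) \<le> ?B" "snd (x T) \<le> ?B" using B_bound[OF adm T x] init by auto
        moreover have "z0 \<le> snd (x T)" using z_mono[OF x T] init by simp
        ultimately show "norm (x T) \<le> ?B + (\<bar>z0\<bar> + \<bar>?B\<bar>)" by linarith
      qed blast
      have bounds: "norm (fst (x t)) \<le> ?B" "snd (x t) \<le> ?B" if "t \<ge> 0" for t
        using B_bound[OF adm that x] x0 by auto
      have mono: "snd (x s) \<le> snd (x t)" if "0 \<le> s" "s \<le> t" for s t
        using that by (intro z_mono[OF primitive_on_subinterval[OF x[of t]]]) auto
      obtain zinf where zinf: "zinf \<le> ?B" "((\<lambda>t. snd (x t)) \<longlongrightarrow> zinf) at_top" "\<And>t. t \<ge> 0 \<Longrightarrow> snd (x t) \<le> zinf"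
        using mono_bounded_tendsto_Sup[of "\<lambda>t. snd (x t)" ?B, OF mono bounds(2)] by blast
      have glob: "global_sol f V \<Gamma> \<epsilon> \<theta> d (\<xi>0, z0) x"
        unfolding global_sol_def sol_on_spike[OF N]
      proof (intro allI, unfold sol_on_def, intro ballI conjI)
        fix T t :: real assume t: "t \<in> {0..<T}"
        show "(\<lambda>s. F (\<theta>' s) (d' s) (x s)) integrable_on {0..t}" by (rule primitive_onD(1)[OF x])
        show "x t = (\<xi>0, z0) + integral {0..t} (\<lambda>s. F (\<theta>' s) (d' s) (x s))"
          using primitive_onD(3)[OF x[of t], of t] t x0 by simp
      qed
      have uniq: "y t = x t" if y: "sol_on f V \<Gamma> \<epsilon> \<theta> d (\<xi>0, z0) T y" and t: "t \<in> {0..<T}" for T y t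
      proof -
        have sol: "(\<lambda>s. F (\<theta>' s) (d' s) (y s)) integrable_on {0..s}"
          "y s = (\<xi>0, z0) + integral {0..s} (\<lambda>s. F (\<theta>' s) (d' s) (y s))" if "s \<in> {0..t}" for s
          using iffD1[OF sol_on_spike[OF N] y] t that unfolding sol_on_def by auto
        have "continuous_on {0..t} (\<lambda>s. (\<xi>0, z0) + integral {0..s} (\<lambda>s. F (\<theta>' s) (d' s) (y s)))"
          using t by (intro continuous_on_add continuous_on_const indefinite_integral_continuous_1 sol(1)) auto
        then have yc: "continuous_on {0..t} y" by (rule continuous_on_eq) (rule sol(2)[symmetric])
        have y0: "y 0 = (\<xi>0, z0)" using sol(2)[of 0] t by simp
        \<comment> \<open>\<open>sol_on\<close> asks only for integrability of the right-hand side;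
          its boundedness along \<open>y\<close> follows from the continuity of
          \<open>y\<close>.\<close>
        have "primitive_on 0 t y (\<lambda>s. F (\<theta>' s) (d' s) (y s))"
          by (rule primitive_onI) (simp_all only: rhs_integrable[OF adm yc] y0 sol(2))
        from solution_unique[OF adm this x] show ?thesis using y0 x0 t by simp
      qed
      have lim1: "Limsup at_top (\<lambda>t. ereal (U (x t))) \<le> ereal \<epsilon>"
        by (rule limsup_U_le_eps[OF adm x zinf(2,3)])
      \<comment> \<open>Truncation replaces values by zero only, and zero stays below the
        nonnegative threshold, so no new exceedance appears.\<close>
      have tail_d: "\<exists>T\<ge>0. negligible {t \<in> {T..}. real_of_ereal (ess_limsup_norm d) + \<eta> < norm (d' t)}"
        if \<eta>: "\<eta> > 0" for \<eta>
      proof -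
        obtain T where T: "T \<ge> 0" "negligible {t \<in> {T..}. real_of_ereal (ess_limsup_norm d) + \<eta> < norm (d t)}"
          using Linf_input_ess_limsup_norm(2)[OF d \<eta>] by blast
        have "{t \<in> {T..}. real_of_ereal (ess_limsup_norm d) + \<eta> < norm (d' t)} \<subseteq>
            {t \<in> {T..}. real_of_ereal (ess_limsup_norm d) + \<eta> < norm (d t)}"
          using Linf_input_ess_limsup_norm(1)[OF d] \<eta> by (auto simp: d'_def split: if_splits)
        then show ?thesis using T negligible_subset by blast
      qed
      have tail_\<theta>: "\<exists>T\<ge>0. negligible {t \<in> {T..}. real_of_ereal (ess_limsup_norm \<theta>) + \<eta> < norm (\<theta>' t)}"
        if \<eta>: "\<eta> > 0" for \<eta>
      proof -
        obtain T where T: "T \<ge> 0" "negligible {t \<in> {T..}. real_of_ereal (ess_limsup_norm \<theta>) + \<eta> < norm (\<theta> t)}"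
          using Linf_input_ess_limsup_norm(2)[OF \<theta> \<eta>] by blast
        have "{t \<in> {T..}. real_of_ereal (ess_limsup_norm \<theta>) + \<eta> < norm (\<theta>' t)} \<subseteq>
            {t \<in> {T..}. real_of_ereal (ess_limsup_norm \<theta>) + \<eta> < norm (\<theta> t)}"
          using Linf_input_ess_limsup_norm(1)[OF \<theta>] \<eta> by (auto simp: \<theta>'_def split: if_splits)
        then show ?thesis using T negligible_subset by blast
      qed
      have lim2: "Limsup at_top (\<lambda>t. ereal (U (x t))) \<le> ereal (\<gamma> (gain (real_of_ereal (ess_limsup_norm d))
          (real_of_ereal (ess_limsup_norm \<theta>)) (exp zinf)))"
        by (rule limsup_U_le_gain[OF cmp \<gamma> \<sigma> adm x zinf(2) tail_d tail_\<theta>])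
      have trans: "U (x t) \<le> \<sigma> (V \<xi>0 z0) t + \<gamma> (gain n1 n2 (exp z0))" if t: "t \<ge> 0" for t
      proof -
        have "U (x t) \<le> \<sigma> (U (x 0)) (t - 0) + \<gamma> (gain n1 n2 (exp z0))"
        proof (rule U_comparison[OF cmp adm x order_refl t negligible_empty])
          show "norm (d' s) \<le> n1 \<and> norm (\<theta>' s) \<le> n2" if "s \<in> {0..t} - {}" for s
            using admissibleD[OF adm, of s] that by simp
        qed (simp add: x0)
        then show ?thesis by (simp add: x0)
      qed
      show "\<exists>x. global_sol f V \<Gamma> \<epsilon> \<theta> d (\<xi>0, z0) x \<and>
         (\<forall>T y. sol_on f V \<Gamma> \<epsilon> \<theta> d (\<xi>0, z0) T y \<longrightarrow> (\<forall>t\<in>{0..<T}. y t = x t)) \<and>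
         (\<exists>zinf. ((\<lambda>t. snd (x t)) \<longlongrightarrow> zinf) at_top \<and>
            Limsup at_top (\<lambda>t. ereal (V (fst (x t)) (snd (x t)))) \<le> ereal \<epsilon> \<and>
            Limsup at_top (\<lambda>t. ereal (V (fst (x t)) (snd (x t)))) \<le>
              ereal (\<gamma> (chi a b lam \<kappa> (real_of_ereal (ess_limsup_norm d))
                                         (real_of_ereal (ess_limsup_norm \<theta>)) (exp zinf))) \<and>
            (\<forall>t\<ge>0. V (fst (x t)) (snd (x t)) \<le> \<sigma> (V \<xi>0 z0) t +
                       \<gamma> (chi a b lam \<kappa> (real_of_ereal (ess_norm d)) (real_of_ereal (ess_norm \<theta>)) (exp z0)) \<and>
                    norm (fst (x t)) \<le> B \<xi>0 z0 (real_of_ereal (ess_norm d)) (real_of_ereal (ess_norm \<theta>)) \<and>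
                    z0 \<le> snd (x t) \<and> snd (x t) \<le> zinf) \<and>
            zinf \<le> B \<xi>0 z0 (real_of_ereal (ess_norm d)) (real_of_ereal (ess_norm \<theta>)))"
        using glob uniq zinf lim1 lim2 trans bounds(1) mono[of 0] x0
        unfolding n1_def[symmetric] n2_def[symmetric]
        by (intro exI[of _ x] exI[of _ zinf] conjI allI impI ballI) auto
    qed
  qed
qed

end

theorem theorem8:
  fixes f :: "'a::euclidean_space \<Rightarrow> real \<Rightarrow> 'p::euclidean_space \<Rightarrow> 'l::euclidean_space \<Rightarrow> 'a"
    and V :: "'a \<Rightarrow> real \<Rightarrow> real"
    and V\<xi> :: "'a \<Rightarrow> real \<Rightarrow> 'a" and Vz :: "'a \<Rightarrow> real \<Rightarrow> real"
    and \<Theta> :: "'p set" and D :: "'l set"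
    and \<Gamma> \<epsilon> a b c \<delta> :: real
    and \<kappa> lam \<rho> :: "real \<Rightarrow> real"
  assumes \<Theta>: "closed \<Theta>" "0 \<in> \<Theta>"
    and D: "closed D" "0 \<in> D"
    and \<Gamma>: "\<Gamma> > 0" and \<epsilon>: "\<epsilon> > 0"
    and f_cont: "continuous_on (UNIV \<times> UNIV \<times> \<Theta> \<times> D) (\<lambda>(\<xi>, z, th, dd). f \<xi> z th dd)"
    and f_lip: "\<And>x0 R. \<exists>e>0. \<exists>L. \<forall>x1\<in>ball x0 e. \<forall>x2\<in>ball x0 e. \<forall>th\<in>\<Theta>. \<forall>dd\<in>D.
                   norm th \<le> R \<longrightarrow> norm dd \<le> R \<longrightarrow>
                   norm (f (fst x1) (snd x1) th dd - f (fst x2) (snd x2) th dd) \<le> L * dist x1 x2"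
    and f_zero: "\<And>z th. th \<in> \<Theta> \<Longrightarrow> f 0 z th 0 = 0"
    and V_deriv: "\<And>\<xi> z. ((\<lambda>(x, y). V x y) has_derivative (\<lambda>(h, k). V\<xi> \<xi> z \<bullet> h + Vz \<xi> z * k)) (at (\<xi>, z))"
    and V\<xi>_cont: "continuous_on UNIV (\<lambda>(x, y). V\<xi> x y)"
    and Vz_cont: "continuous_on UNIV (\<lambda>(x, y). Vz x y)"
    and V_zero: "\<And>z. V 0 z = 0"
    and V_pos: "\<And>\<xi> z. \<xi> \<noteq> 0 \<Longrightarrow> V \<xi> z > 0"
    and bnd: "\<And>M. M > 0 \<Longrightarrow> bounded {(\<xi>, z). z \<in> {-M..M} \<and> V \<xi> z \<le> M}"
    and K: "class_Kinf \<kappa>" "class_Kinf lam" "class_Kinf \<rho>"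
    and pos_consts: "a > 0" "c > 0" "\<delta> > 0" "b \<ge> 0"
    and \<rho>_lin: "\<And>s. 0 \<le> s \<Longrightarrow> s \<le> \<delta> \<Longrightarrow> \<rho> s \<ge> c * s"
    and dissip: "\<And>\<xi> z th dd. th \<in> \<Theta> \<Longrightarrow> dd \<in> D \<Longrightarrow>
        V\<xi> \<xi> z \<bullet> f \<xi> z th dd + \<Gamma> * exp (- z) * Vz \<xi> z * pos_part (V \<xi> z - \<epsilon>)
          \<le> - \<rho> (V \<xi> z) + chi a b lam \<kappa> (norm dd) (norm th) (exp z)"
  shows "(\<exists>B \<gamma> \<sigma>. continuous_on (UNIV \<times> UNIV \<times> {0..} \<times> {0..}) (\<lambda>(x, z, s1, s2). B x z s1 s2) \<and>
            class_Kinf \<gamma> \<and> class_KL \<sigma> \<and>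
            conclusion_holds f V \<Gamma> \<epsilon> \<Theta> D a b lam \<kappa> B \<gamma> \<sigma>) \<and>
         ((\<forall>s\<ge>0. \<rho> s \<ge> c * s) \<longrightarrow>
          (\<exists>B. continuous_on (UNIV \<times> UNIV \<times> {0..} \<times> {0..}) (\<lambda>(x, z, s1, s2). B x z s1 s2) \<and>
               conclusion_holds f V \<Gamma> \<epsilon> \<Theta> D a b lam \<kappa> B (\<lambda>s. s / c) (\<lambda>s t. exp (- c * t) * s)))"
proof -
  interpret adaptive_system f V V\<xi> Vz \<Theta> D \<Gamma> \<epsilon> a b \<kappa> lam \<rho>
    by unfold_locales (fact assms)+
  obtain \<beta> where \<beta>: "class_Kinf \<beta>" "\<And>s. s \<ge> 0 \<Longrightarrow> \<beta> s \<ge> 0" "\<And>s. s \<ge> 0 \<Longrightarrow> \<rho> (\<beta> s) = s"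
    using class_Kinf_inverse[OF K(3)] by blast
  \<comment> \<open>The factor 2 in the gain and the halved rate have one origin: half of
    \<open>\<rho>\<close> is spent on the input and half on the decay.\<close>
  let ?\<sigma> = "\<lambda>s t. exp (- (c / 2) * t) * (s * exp (s / \<delta>))" and ?\<gamma> = "\<lambda>s. \<beta> (2 * s)"
  have cmp: "comparison_pair \<rho> ?\<sigma> ?\<gamma>"
    using K(3) pos_consts(2,3) \<rho>_lin \<beta>(2,3) by (rule comparison_pair_saturated)
  have \<sigma>: "class_KL ?\<sigma>" using pos_consts by (intro class_KL_exp) auto
  have \<gamma>: "class_Kinf ?\<gamma>" using \<beta>(1) by (intro class_Kinf_rescale) auto
  obtain B where B: "continuous_on (UNIV \<times> UNIV \<times> {0..} \<times> {0..}) (\<lambda>(x, z, s1, s2). B x z s1 s2)"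
    "\<And>\<sigma> \<gamma>. comparison_pair \<rho> \<sigma> \<gamma> \<Longrightarrow> continuous_on {0..} \<gamma> \<Longrightarrow> (\<And>s. s \<ge> 0 \<Longrightarrow> (\<sigma> s \<longlongrightarrow> 0) at_top) \<Longrightarrow>
       conclusion_holds f V \<Gamma> \<epsilon> \<Theta> D a b lam \<kappa> B \<gamma> \<sigma>"
    using conclusion_of_comparison[OF cmp \<sigma> \<gamma>] by blast
  have "conclusion_holds f V \<Gamma> \<epsilon> \<Theta> D a b lam \<kappa> B ?\<gamma> ?\<sigma>"
    using \<sigma> by (intro B(2)[OF cmp class_Kinf_continuous[OF \<gamma>]]) (auto simp: class_KL_def)
  moreover have "conclusion_holds f V \<Gamma> \<epsilon> \<Theta> D a b lam \<kappa> B (\<lambda>s. s / c) (\<lambda>s t. exp (- c * t) * s)"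
    if lin: "\<forall>s\<ge>0. \<rho> s \<ge> c * s"
  proof (rule B(2))
    show "comparison_pair \<rho> (\<lambda>s t. exp (- c * t) * s) (\<lambda>s. s / c)"
      using pos_consts lin by (intro comparison_pair_linear) auto
    show "continuous_on {0..} (\<lambda>s. s / c)" using pos_consts by (intro continuous_intros) auto
    show "((\<lambda>t. exp (- c * t) * s) \<longlongrightarrow> 0) at_top" for s
      using pos_consts(2) by (rule tendsto_exp_decay)
  qed
  ultimately show ?thesis using B(1) \<sigma> \<gamma> by blast
qed

end
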